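(* Let $(M,g)$ be an $n$-dimensional Riemannian manifold with an isometric action of a unimodular Lie group $G$ and a one-dimensional immersed connected submanifold $\tilde\Sigma\subset M$ as in the geometric setting of the context (polar action, with either the boundaryless or the boundary version of the regularity assumptions); let $\Sigma$ and $M_0$ be the associated objects. Consider $$-\Delta_Mu+f(x,u(x))=0.\qquad( * )$$ (i) Assume $f\in C(M\times\mathbb R)$ is radial in the first variable and locally Lipschitz in the second, i.e. for every compact $K\subset M\times\mathbb R$ there is $C_K>0$ with $|f(x,y_1)-f(x,y_2)|\le C_K|y_1-y_2|$ for all $(x,y_1),(x,y_2)\in K$. Let $u_1,u_2$ be two maximal radial solutions of $( * )$ of class $C^2$ for which there exists $p\in\Sigma$ with $u_1(p)=u_2(p)$ and $\nabla u_1(p)=\nabla u_2(p)$. Then $u_1\equiv u_2$ in $M_0$. (ii) Assume $f$ is as in (i) and $f(\cdot,0)=0$. Let $u$ be a maximal radial solution of $( * )$ of class $C^2$ for which there exists $p\in\Sigma$ with $u(p)=0$ and $\nabla u(p)=0$. Then $u\equiv0$ in $M_0$. (iii) Assume $f\in C(M\times(0,\infty))$ is radial in the first variable and that for every compact $K\subset M\times(0,\infty)$ there is $C_K>0$ with $|f(x,y_1)-f(x,y_2)|\le C_K|y_1-y_2|$ for all $(x,y_1),(x,y_2)\in K$. Let $u_1,u_2$ be two maximal radial solutions of $( * )$ of class $C^2$ with $u_j>0$, $j=1,2$, for which there exists $p\in\Sigma$ with $u_1(p)=u_2(p)$ and $\nabla u_1(p)=\nabla u_2(p)$. Then $u_1\equiv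 u_2$ in $M_0$.
   Context: Geometric setting. $M$ is a connected, paracompact, Hausdorff $n$-dimensional smooth manifold, possibly with boundary, with Riemannian metric $g$; $\Delta_M$ is the Laplace–Beltrami operator. A Lie group $G$ acts on $M$ by isometries, and $\tilde\Sigma$ is an immersed connected submanifold of $M$ such that for each $x\in\tilde\Sigma\setminus\partial M$ with $G\cdot x\ne\{x\}$ one has $T_xM=T_x\tilde\Sigma\oplus T_x(G\cdot x)$ (polar action). One of the following regularity assumptions holds. (a) $M$ has empty boundary; $\Sigma$ denotes the set of points of $\tilde\Sigma$ not fixed by the action, and $M_0=\{x\in M: G\cdot x\neq\{x\}\}$. (b) $M$ has boundary; $\Sigma$ denotes the set of points of $\tilde\Sigma$ that are neither fixed points nor boundary points, and $M_0=\{x\in M: G\cdot x\neq\{x\}\}\setminus\partial M$. In either case it is assumed that $\Sigma$ is an open, embedded, connected submanifold of $\tilde\Sigma$; that for $x\in\Sigma$ the orbit $G\cdot x$ has finite Riemannian measure $A(x)$ (the volume of the orbit as a submanifold of $M$), with $A:\Sigma\to\mathbb R^+$ smooth; and that $M_0$ is open in $M$. The $G$-action on $\Sigma$ gives the whole of $M_0$, i.e. $M_0=G\cdot\Sigma$. A function $u$ is radial if $u(g\cdot x)=u(x)$ for all $g\in G$ and all $x$ in the ($G$-invariant) domain; $f(x,y)$ is radial in the first variable if $f(g\cdot x,y)=f(x,y)$. A maximal radial solution of class $C^2$ is a radial function $u\in C^2(M_0)$ solving the equation in $M_0$. *)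

theory Defs
  imports "HOL-Analysis.Analysis" "HOL-Library.Extended_Nat" "HOL-Algebra.Group_Action"
begin

section \<open>Differentiability classes in Euclidean space\<close>

primrec C_open :: "nat \<Rightarrow> ('a::real_normed_vector \<Rightarrow> 'b::real_normed_vector) \<Rightarrow> 'a set \<Rightarrow> bool" where
  "C_open 0 f U \<longleftrightarrow> continuous_on U f"
| "C_open (Suc k) f U \<longleftrightarrow> (\<forall>x\<in>U. f differentiable (at x)) \<and>
     (\<forall>v. C_open k (\<lambda>x. frechet_derivative f (at x) v) U)"

text \<open>On a set that need not be open (relatively open subsets of a half-space or of a
  coordinate subspace), being of class \<open>C\<^sup>r\<close> means having local \<open>C\<^sup>r\<close> extensions to
  open sets; \<open>r = \<infinity>\<close> is smoothness.\<close>

definition C_on :: "enat \<Rightarrow> 'a::real_normed_vector set \<Rightarrow> ('a \<Rightarrow> 'b::real_normed_vector) \<Rightarrow> bool" where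
  "C_on r S f \<longleftrightarrow> (\<forall>x\<in>S. \<exists>W h. open W \<and> x \<in> W \<and>
     (\<forall>k. enat k \<le> r \<longrightarrow> C_open k h W) \<and> (\<forall>y\<in>S \<inter> W. h y = f y))"


section \<open>Manifolds\<close>

definition half_space :: "'e::euclidean_space set" where
  "half_space = {x. 0 \<le> x \<bullet> (SOME b. b \<in> Basis)}"

definition coord_space :: "'n set \<Rightarrow> (real^'n::finite) set" where
  "coord_space J = {x. \<forall>i. i \<notin> J \<longrightarrow> x $ i = 0}"

text \<open>Charts map homeomorphically onto relatively open subsets of a model set. The model
  \<open>half_space\<close> gives manifolds, possibly with boundary, of the dimension of the ambient type; the
  model \<open>coord_space J\<close> gives manifolds without boundary of dimension \<open>card J\<close>. The latter
  covers dimension 0 (discrete groups) and orbits, whose dimension is one less than that of the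
  ambient manifold. Any smooth atlas is allowed, not only a maximal one.\<close>

type_synonym ('x, 'e) chart = "'x set \<times> ('x \<Rightarrow> 'e)"

record ('x, 'e) mfd =
  mtop :: "'x topology"
  charts :: "('x, 'e) chart set"
  model :: "'e set"

abbreviation points :: "('x, 'e) mfd \<Rightarrow> 'x set" where
  "points X \<equiv> topspace (mtop X)"

abbreviation chart_inv :: "('x, 'e) chart \<Rightarrow> 'e \<Rightarrow> 'x" where
  "chart_inv c \<equiv> inv_into (fst c) (snd c)"

definition charts_at :: "('x, 'e) mfd \<Rightarrow> 'x \<Rightarrow> ('x, 'e) chart set" where
  "charts_at X x = {c \<in> charts X. x \<in> fst c}"

definition paracompact_space :: "'x topology \<Rightarrow> bool" where
  "paracompact_space X \<longleftrightarrow> (\<forall>\<U>. (\<forall>U\<in>\<U>. openin X U) \<and> \<Union>\<U> = topspace X \<longrightarrow>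
     (\<exists>\<V>. (\<forall>V\<in>\<V>. openin X V \<and> (\<exists>U\<in>\<U>. V \<subseteq> U)) \<and> \<Union>\<V> = topspace X \<and> locally_finite_in X \<V>))"

definition second_countable_space :: "'x topology \<Rightarrow> bool" where
  "second_countable_space X \<longleftrightarrow> (\<exists>\<B>. countable \<B> \<and> (\<forall>V\<in>\<B>. openin X V) \<and>
     (\<forall>U x. openin X U \<and> x \<in> U \<longrightarrow> (\<exists>V\<in>\<B>. x \<in> V \<and> V \<subseteq> U)))"

definition smooth_manifold :: "('x, 'e::real_normed_vector) mfd \<Rightarrow> bool" where
  "smooth_manifold X \<longleftrightarrow>
     Hausdorff_space (mtop X) \<and> paracompact_space (mtop X) \<and>
     (\<Union>c\<in>charts X. fst c) = points X \<and>
     (\<forall>c\<in>charts X. openin (mtop X) (fst c) \<and>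
        openin (top_of_set (model X)) (snd c ` fst c) \<and>
        homeomorphic_map (subtopology (mtop X) (fst c)) (top_of_set (snd c ` fst c)) (snd c)) \<and>
     (\<forall>c\<in>charts X. \<forall>d\<in>charts X. C_on \<infinity> (snd c ` (fst c \<inter> fst d)) (snd d \<circ> chart_inv c))"

text \<open>Only meaningful for the model \<open>half_space\<close>.\<close>

definition boundary :: "('x, 'e::euclidean_space) mfd \<Rightarrow> 'x set" where
  "boundary X = {x. \<exists>c\<in>charts_at X x. snd c x \<bullet> (SOME b. b \<in> Basis) = 0}"

definition prod_mfd :: "('x, 'e) mfd \<Rightarrow> ('y, 'f) mfd \<Rightarrow> ('x \<times> 'y, 'e \<times> 'f) mfd" where
  "prod_mfd X Y = \<lparr>mtop = prod_topology (mtop X) (mtop Y),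
     charts = {(fst c \<times> fst d, map_prod (snd c) (snd d)) | c d. c \<in> charts X \<and> d \<in> charts Y},
     model = model X \<times> model Y\<rparr>"

definition restrict_mfd :: "('x, 'e) mfd \<Rightarrow> 'x set \<Rightarrow> ('x, 'e) mfd" where
  "restrict_mfd X D = \<lparr>mtop = subtopology (mtop X) D,
     charts = {(fst c \<inter> D, snd c) | c. c \<in> charts X}, model = model X\<rparr>"

definition C_map :: "enat \<Rightarrow> ('x, 'e::real_normed_vector) mfd \<Rightarrow>
    ('y, 'f::real_normed_vector) mfd \<Rightarrow> ('x \<Rightarrow> 'y) \<Rightarrow> bool" where
  "C_map r X Y F \<longleftrightarrow> continuous_map (mtop X) (mtop Y) F \<and>
     (\<forall>c\<in>charts X. \<forall>d\<in>charts Y.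
        C_on r (snd c ` {x \<in> fst c. F x \<in> fst d}) (snd d \<circ> F \<circ> chart_inv c))"

definition C_fun :: "enat \<Rightarrow> ('x, 'e::real_normed_vector) mfd \<Rightarrow> 'x set \<Rightarrow> ('x \<Rightarrow> real) \<Rightarrow> bool" where
  "C_fun r X D u \<longleftrightarrow> (\<forall>c\<in>charts X. C_on r (snd c ` (fst c \<inter> D)) (u \<circ> chart_inv c))"

text \<open>The tangent space at a point is represented, in each chart, by \<open>span (model X)\<close>, and
  \<open>coord_diff c d F x\<close> is the differential of \<open>F\<close> at \<open>x\<close> in the charts \<open>c\<close> around \<open>x\<close> and
  \<open>d\<close> around \<open>F x\<close>. It is determined on \<open>span (model X)\<close> only, and only used there.\<close>

definition coord_diff :: "('x, 'e::real_normed_vector) chart \<Rightarrow> ('y, 'f::real_normed_vector) chart \<Rightarrow>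
    ('x \<Rightarrow> 'y) \<Rightarrow> 'x \<Rightarrow> 'e \<Rightarrow> 'f" where
  "coord_diff c d F x =
     frechet_derivative (snd d \<circ> F \<circ> chart_inv c) (at (snd c x) within snd c ` fst c)"

text \<open>An immersed submanifold is a subset with its own, possibly finer, topology and its own smooth
  structure, for which the inclusion is a smooth immersion.\<close>

definition immersed_submanifold ::
    "('x, 'f::real_normed_vector) mfd \<Rightarrow> ('x, 'e::real_normed_vector) mfd \<Rightarrow> bool" where
  "immersed_submanifold N X \<longleftrightarrow> smooth_manifold N \<and> points N \<subseteq> points X \<and> C_map \<infinity> N X (\<lambda>x. x) \<and>
     (\<forall>x\<in>points N. \<forall>c\<in>charts_at N x. \<forall>d\<in>charts_at X x.
        inj_on (coord_diff c d (\<lambda>x. x) x) (span (model N)))"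

definition embedded_submanifold ::
    "('x, 'f::real_normed_vector) mfd \<Rightarrow> ('x, 'e::real_normed_vector) mfd \<Rightarrow> bool" where
  "embedded_submanifold N X \<longleftrightarrow>
     immersed_submanifold N X \<and> mtop N = subtopology (mtop X) (points N)"


section \<open>Riemannian metrics\<close>

text \<open>A metric assigns to each chart \<open>c\<close> and point \<open>x\<close> the matrix \<open>(g\<^sub>i\<^sub>j(x))\<close> in the
  coordinates of \<open>c\<close>.\<close>

type_synonym ('x, 'n) metric = "('x, real^'n) chart \<Rightarrow> 'x \<Rightarrow> real^'n^'n"

definition riemannian_metric :: "('x, real^'n::finite) mfd \<Rightarrow> ('x, 'n) metric \<Rightarrow> bool" where
  "riemannian_metric X g \<longleftrightarrow>
     (\<forall>c\<in>charts X. C_on \<infinity> (snd c ` fst c) (g c \<circ> chart_inv c)) \<and>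
     (\<forall>x\<in>points X. \<forall>c\<in>charts_at X x.
        transpose (g c x) = g c x \<and> (\<forall>v. v \<noteq> 0 \<longrightarrow> 0 < v \<bullet> (g c x *v v))) \<and>
     (\<forall>x\<in>points X. \<forall>c\<in>charts_at X x. \<forall>d\<in>charts_at X x. \<forall>v w.
        v \<bullet> (g c x *v w) =
        coord_diff c d (\<lambda>x. x) x v \<bullet> (g d x *v coord_diff c d (\<lambda>x. x) x w))"

definition isometry_on :: "('x, real^'n::finite) mfd \<Rightarrow> ('x, 'n) metric \<Rightarrow> ('x \<Rightarrow> 'x) \<Rightarrow> bool" where
  "isometry_on X g F \<longleftrightarrow> bij_betw F (points X) (points X) \<and>
     C_map \<infinity> X X F \<and> C_map \<infinity> X X (inv_into (points X) F) \<and>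
     (\<forall>x\<in>points X. \<forall>c\<in>charts_at X x. \<forall>d\<in>charts_at X (F x). \<forall>v w.
        v \<bullet> (g c x *v w) = coord_diff c d F x v \<bullet> (g d (F x) *v coord_diff c d F x w))"

definition partial :: "'n::finite \<Rightarrow> (real^'n \<Rightarrow> real) \<Rightarrow> real^'n \<Rightarrow> real" where
  "partial i h y = frechet_derivative h (at y) (axis i 1)"

text \<open>The coordinates of the gradient in the chart \<open>c\<close>: \<open>(\<nabla>u)\<^sup>i = \<Sum>\<^sub>j g\<^sup>i\<^sup>j \<partial>\<^sub>j u\<close>.\<close>

definition gradient :: "('x, 'n) metric \<Rightarrow> ('x, real^'n::finite) chart \<Rightarrow> ('x \<Rightarrow> real) \<Rightarrow> 'x \<Rightarrow> real^'n"
  where "gradient g c u x =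
    matrix_inv (g c x) *v (\<chi> j. partial j (u \<circ> chart_inv c) (snd c x))"

text \<open>The Laplace-Beltrami operator at an interior point in the coordinates of the chart \<open>c\<close>:
  \<open>\<Delta>u = |g|\<^sup>-\<^sup>1\<^sup>/\<^sup>2 \<Sum>\<^sub>i \<partial>\<^sub>i (|g|\<^sup>1\<^sup>/\<^sup>2 \<Sum>\<^sub>j g\<^sup>i\<^sup>j \<partial>\<^sub>j u)\<close>.
  The value does not depend on \<open>c\<close>.\<close>

definition laplace_beltrami :: "('x, 'n) metric \<Rightarrow> ('x, real^'n::finite) chart \<Rightarrow>
    ('x \<Rightarrow> real) \<Rightarrow> 'x \<Rightarrow> real" where
  "laplace_beltrami g c u x =
     (let q = (\<lambda>y. g c (chart_inv c y)); w = (\<lambda>y. sqrt (det (q y))); v = u \<circ> chart_inv c in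
      (\<Sum>i\<in>UNIV. partial i (\<lambda>y. w y * (\<Sum>j\<in>UNIV. matrix_inv (q y) $ i $ j * partial j v y)) (snd c x))
      / w (snd c x))"

definition borel_sigma :: "'x topology \<Rightarrow> 'x measure" where
  "borel_sigma X = sigma (topspace X) {U. openin X U}"

text \<open>Determinant of the metric induced by \<open>g\<close> on the submanifold \<open>N\<close> with model
  \<open>coord_space J\<close>, in the chart \<open>e\<close> of \<open>N\<close>. The Gram matrix of the tangent vectors
  \<open>\<partial>\<^sub>i\<close>, \<open>i \<in> J\<close>, is completed by the identity in the unused coordinates, which does not
  change its determinant (it is 1 if \<open>J = {}\<close>).\<close>

definition induced_det :: "('x, 'n) metric \<Rightarrow> 'n set \<Rightarrow> ('x, real^'n) chart \<Rightarrow>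
    ('x, real^'n::finite) chart \<Rightarrow> 'x \<Rightarrow> real" where
  "induced_det g J e c x = det (\<chi> i j. if i \<in> J \<and> j \<in> J
     then coord_diff e c (\<lambda>x. x) x (axis i 1) \<bullet> (g c x *v coord_diff e c (\<lambda>x. x) x (axis j 1))
     else if i = j then 1 else 0)"

text \<open>The measure that in each chart has the density \<open>sqrt det\<close> with respect to Lebesgue measure
  on \<open>\<real>\<^sup>J\<close>; for \<open>J = {}\<close> this is counting measure.\<close>

definition riemannian_measure :: "('x, real^'n::finite) mfd \<Rightarrow> ('x, 'n) metric \<Rightarrow> 'n set \<Rightarrow>
    ('x, real^'n) mfd \<Rightarrow> 'x measure \<Rightarrow> bool" where
  "riemannian_measure X g J N \<mu> \<longleftrightarrow> sets \<mu> = sets (borel_sigma (mtop N)) \<and>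
     (\<forall>e\<in>charts N. \<forall>c\<in>charts X. \<forall>B\<in>sets \<mu>. B \<subseteq> fst e \<inter> fst c \<longrightarrow>
        emeasure \<mu> B = (\<integral>\<^sup>+t. (let y = (\<chi> i. if i \<in> J then t i else 0) in
          indicator (snd e ` B) y * ennreal (sqrt (induced_det g J e c (chart_inv e y))))
          \<partial>(PiM J (\<lambda>_. lborel))))"


section \<open>Lie groups and isometric actions\<close>

definition lie_group :: "'a monoid \<Rightarrow> ('a, real^'k::finite) mfd \<Rightarrow> bool" where
  "lie_group G L \<longleftrightarrow> group G \<and> smooth_manifold L \<and> second_countable_space (mtop L) \<and>
     (\<exists>J. model L = coord_space J) \<and> carrier G = points L \<and>
     C_map \<infinity> (prod_mfd L L) L (\<lambda>(a, b). a \<otimes>\<^bsub>G\<^esub> b) \<and> C_map \<infinity> L L (\<lambda>a. inv\<^bsub>G\<^esub> a)"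

definition left_haar_measure :: "'a monoid \<Rightarrow> 'a topology \<Rightarrow> 'a measure \<Rightarrow> bool" where
  "left_haar_measure G T \<mu> \<longleftrightarrow> sets \<mu> = sets (borel_sigma T) \<and>
     (\<forall>K. compactin T K \<and> K \<in> sets \<mu> \<longrightarrow> emeasure \<mu> K < \<infinity>) \<and>
     (\<forall>U. openin T U \<and> U \<noteq> {} \<longrightarrow> 0 < emeasure \<mu> U) \<and>
     (\<forall>a\<in>carrier G. \<forall>B\<in>sets \<mu>. emeasure \<mu> (a <#\<^bsub>G\<^esub> B) = emeasure \<mu> B)"

definition unimodular :: "'a monoid \<Rightarrow> 'a topology \<Rightarrow> bool" where
  "unimodular G T \<longleftrightarrow> (\<exists>\<mu>. left_haar_measure G T \<mu> \<and>
     (\<forall>a\<in>carrier G. \<forall>B\<in>sets \<mu>. emeasure \<mu> (B #>\<^bsub>G\<^esub> a) = emeasure \<mu> B))"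

definition isometric_action :: "'a monoid \<Rightarrow> ('a, real^'k::finite) mfd \<Rightarrow>
    ('x, real^'n::finite) mfd \<Rightarrow> ('x, 'n) metric \<Rightarrow> ('a \<Rightarrow> 'x \<Rightarrow> 'x) \<Rightarrow> bool" where
  "isometric_action G L X g \<phi> \<longleftrightarrow> group_action G (points X) \<phi> \<and>
     C_map \<infinity> (prod_mfd L X) X (\<lambda>(a, x). \<phi> a x) \<and> (\<forall>a\<in>carrier G. isometry_on X g (\<phi> a))"

text \<open>The orbit of \<open>x\<close> as a submanifold: the immersed submanifold structure for which the orbit map
  is a submersion, i.e. the one transported from the homogeneous space \<open>G / G\<^sub>x\<close>.\<close>

definition orbit_manifold :: "'a monoid \<Rightarrow> ('a, real^'k::finite) mfd \<Rightarrow> ('x, real^'n::finite) mfd \<Rightarrow>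
    ('a \<Rightarrow> 'x \<Rightarrow> 'x) \<Rightarrow> 'x \<Rightarrow> 'n set \<Rightarrow> ('x, real^'n) mfd \<Rightarrow> bool" where
  "orbit_manifold G L X \<phi> x J N \<longleftrightarrow> points N = orbit G \<phi> x \<and> model N = coord_space J \<and>
     immersed_submanifold N X \<and> C_map \<infinity> L N (\<lambda>a. \<phi> a x) \<and>
     (\<forall>a\<in>carrier G. \<forall>b\<in>charts_at L a. \<forall>e\<in>charts_at N (\<phi> a x).
        coord_diff b e (\<lambda>a. \<phi> a x) a ` span (model L) = span (model N))"

definition orbit_volume :: "'a monoid \<Rightarrow> ('a, real^'k::finite) mfd \<Rightarrow> ('x, real^'n::finite) mfd \<Rightarrow>
    ('x, 'n) metric \<Rightarrow> ('a \<Rightarrow> 'x \<Rightarrow> 'x) \<Rightarrow> 'x \<Rightarrow> ennreal \<Rightarrow> bool" where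
  "orbit_volume G L X g \<phi> x V \<longleftrightarrow> (\<exists>J N \<mu>. orbit_manifold G L X \<phi> x J N \<and>
     riemannian_measure X g J N \<mu> \<and> V = emeasure \<mu> (points N))"

definition direct_sum :: "'e::real_vector set \<Rightarrow> 'e set \<Rightarrow> 'e set \<Rightarrow> bool" where
  "direct_sum T V W \<longleftrightarrow> T = {v + w | v w. v \<in> V \<and> w \<in> W} \<and> V \<inter> W = {0}"

text \<open>\<open>T\<^sub>xM = T\<^sub>xS \<oplus> T\<^sub>x(G \<cdot> x)\<close>, read in the chart \<open>c\<close> of \<open>M\<close>; the tangent
  space of the orbit is the image of the differential at the unit of the orbit map.\<close>

definition polar_at :: "'a monoid \<Rightarrow> ('a, real^'k::finite) mfd \<Rightarrow> ('x, real^'n::finite) mfd \<Rightarrow>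
    ('a \<Rightarrow> 'x \<Rightarrow> 'x) \<Rightarrow> ('x, real) mfd \<Rightarrow> 'x \<Rightarrow> bool" where
  "polar_at G L X \<phi> S x \<longleftrightarrow>
     (\<forall>c\<in>charts_at X x. \<forall>s\<in>charts_at S x. \<forall>b\<in>charts_at L \<one>\<^bsub>G\<^esub>. direct_sum UNIV
        (coord_diff s c (\<lambda>x. x) x ` span (model S))
        (coord_diff b c (\<lambda>a. \<phi> a x) \<one>\<^bsub>G\<^esub> ` span (model L)))"


section \<open>The geometric setting\<close>

text \<open>Points of \<open>D\<close> that are neither fixed points nor boundary points. With \<open>D = M\<close> this is
  \<open>M\<^sub>0\<close> and with \<open>D = \<Sigma>\<^sup>~\<close> it is \<open>\<Sigma>\<close>, both for \<open>\<partial>M = {}\<close>, where the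
  boundary clause is void, and for \<open>\<partial>M \<noteq> {}\<close>.\<close>

definition regular_points :: "'a monoid \<Rightarrow> ('x, 'e::euclidean_space) mfd \<Rightarrow> ('a \<Rightarrow> 'x \<Rightarrow> 'x) \<Rightarrow>
    'x set \<Rightarrow> 'x set" where
  "regular_points G X \<phi> D = {x \<in> D. orbit G \<phi> x \<noteq> {x} \<and> x \<notin> boundary X}"

abbreviation regular_part :: "'a monoid \<Rightarrow> ('x, 'e::euclidean_space) mfd \<Rightarrow> ('a \<Rightarrow> 'x \<Rightarrow> 'x) \<Rightarrow> 'x set"
  where "regular_part G M \<phi> \<equiv> regular_points G M \<phi> (points M)"

abbreviation regular_section :: "'a monoid \<Rightarrow> ('x, 'e::euclidean_space) mfd \<Rightarrow> ('a \<Rightarrow> 'x \<Rightarrow> 'x) \<Rightarrow>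
    ('x, real) mfd \<Rightarrow> 'x set"
  where "regular_section G M \<phi> S \<equiv> regular_points G M \<phi> (points S)"

text \<open>\<open>S\<close> is the one-dimensional immersed submanifold \<open>\<Sigma>\<^sup>~\<close>; it is allowed to have boundary
  points (for rotations of \<open>\<real>\<^sup>n\<close> it is a closed ray), so its model is the half-line.
  Neither orthogonality of the sum in \<open>polar_at\<close> nor an embedding of \<open>\<Sigma>\<close> in \<open>M\<close> (as
  opposed to \<open>\<Sigma>\<^sup>~\<close>) is assumed.\<close>

locale polar_setting =
  fixes M :: "('x, real^'n::finite) mfd"
    and g :: "('x, 'n) metric"
    and G :: "'a monoid"
    and L :: "('a, real^'k::finite) mfd"
    and \<phi> :: "'a \<Rightarrow> 'x \<Rightarrow> 'x"
    and S :: "('x, real) mfd"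
    and A :: "'x \<Rightarrow> real"
  assumes manifold: "smooth_manifold M" "model M = half_space" "connected_space (mtop M)"
    and metric: "riemannian_metric M g"
    and lie_group: "lie_group G L"
    and action: "isometric_action G L M g \<phi>"
    and section_manifold: "model S = half_space" "immersed_submanifold S M" "connected_space (mtop S)"
    and polar: "\<And>x. x \<in> points S - boundary M \<Longrightarrow> orbit G \<phi> x \<noteq> {x} \<Longrightarrow> polar_at G L M \<phi> S x"
    and sigma: "openin (mtop S) (regular_section G M \<phi> S)"
      "connectedin (mtop S) (regular_section G M \<phi> S)"
      "embedded_submanifold (restrict_mfd S (regular_section G M \<phi> S)) S"
    and orbit_area: "\<And>x. x \<in> regular_section G M \<phi> S \<Longrightarrow>
        0 < A x \<and> orbit_volume G L M g \<phi> x (ennreal (A x))"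
    and area_smooth: "C_fun \<infinity> S (regular_section G M \<phi> S) A"
    and regular_open: "openin (mtop M) (regular_part G M \<phi>)"
    and regular_orbits: "regular_part G M \<phi> =
        (\<Union>x\<in>regular_section G M \<phi> S. orbit G \<phi> x)"


section \<open>Radial solutions\<close>

text \<open>\<open>f \<in> C(M \<times> Y)\<close>, radial in the first variable and locally Lipschitz in the second.\<close>

definition radial_nonlinearity :: "'a monoid \<Rightarrow> ('x, 'e) mfd \<Rightarrow> ('a \<Rightarrow> 'x \<Rightarrow> 'x) \<Rightarrow> real set \<Rightarrow>
    ('x \<Rightarrow> real \<Rightarrow> real) \<Rightarrow> bool" where
  "radial_nonlinearity G M \<phi> Y f \<longleftrightarrow>
     continuous_map (prod_topology (mtop M) (top_of_set Y)) euclideanreal (\<lambda>(x, y). f x y) \<and>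
     (\<forall>a\<in>carrier G. \<forall>x\<in>points M. \<forall>y\<in>Y. f (\<phi> a x) y = f x y) \<and>
     (\<forall>K. compactin (prod_topology (mtop M) (top_of_set Y)) K \<longrightarrow>
        (\<exists>C>0. \<forall>x y1 y2. (x, y1) \<in> K \<and> (x, y2) \<in> K \<longrightarrow> \<bar>f x y1 - f x y2\<bar> \<le> C * \<bar>y1 - y2\<bar>))"

definition maximal_radial_solution :: "'a monoid \<Rightarrow> ('x, real^'n::finite) mfd \<Rightarrow> ('x, 'n) metric \<Rightarrow>
    ('a \<Rightarrow> 'x \<Rightarrow> 'x) \<Rightarrow> ('x \<Rightarrow> real \<Rightarrow> real) \<Rightarrow> ('x \<Rightarrow> real) \<Rightarrow> bool" where
  "maximal_radial_solution G M g \<phi> f u \<longleftrightarrow>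
     (\<forall>a\<in>carrier G. \<forall>x\<in>regular_part G M \<phi>. u (\<phi> a x) = u x) \<and>
     C_fun 2 M (regular_part G M \<phi>) u \<and>
     (\<forall>x\<in>regular_part G M \<phi>. \<forall>c\<in>charts_at M x. - laplace_beltrami g c u x + f x (u x) = 0)"

end

theory Submission
  imports Defs
begin

text \<open>
  Fix \<open>p \<in> \<Sigma>\<close>, work in a chart of \<open>M\<close> at \<open>p\<close>, and let \<open>w = u\<^sub>1 - u\<^sub>2\<close>. Being radial, \<open>w\<close> is annihilated by
  the fundamental vector fields \<open>X\<close> of the action; differentiating \<open>Dw(X) = 0\<close> once more expresses
  \<open>D\<^sup>2w(\<cdot>, X)\<close> through \<open>Dw\<close>. By polarity these fields together with the velocity \<open>\<sigma>'\<close> of a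
  parametrization \<open>\<sigma>\<close> of \<open>\<Sigma>\<close> span all tangent directions near \<open>p\<close>. So, with \<open>W = w \<circ> \<sigma>\<close>, one gets
  \<open>\<nabla>w = W' \<eta>\<close> and \<open>\<Delta>w = \<kappa> W'' + m W'\<close> along \<open>\<sigma>\<close>, where \<open>\<kappa> > 0\<close> because \<open>\<kappa>\<close> is the dual metric
  evaluated at the nonzero covector \<open>\<eta>\<close>. The Lipschitz condition turns the equation into
  \<open>\<bar>W''\<bar> \<le> C (\<bar>W\<bar> + \<bar>W'\<bar>)\<close>, and Gronwall's argument shows that \<open>W\<close> vanishes near \<open>p\<close> as soon as it
  vanishes to first order at one point. Hence the interior in \<open>\<Sigma>\<close> of the coincidence set of \<open>u\<^sub>1\<close> and
  \<open>u\<^sub>2\<close> is open and closed, and \<open>\<Sigma>\<close> is connected.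
\<close>

section \<open>Continuously differentiable functions\<close>

text \<open>A Frechet derivative at a point of an open set depends only on the germ of the function
  there, so agreement on \<open>U\<close> passes to every order by induction. This replaces the
  local extensions supplied by \<open>C_on\<close> by the function itself, and it also restricts
  \<open>C_open\<close> to smaller open sets.\<close>

lemma C_open_transform:
  assumes "C_open k h W" "open U" "U \<subseteq> W" "\<And>y. y \<in> U \<Longrightarrow> f y = h y"
  shows "C_open k f U"
  using assms
proof (induction k arbitrary: f h)
  case 0
  then show ?case
    by simp (metis continuous_on_cong continuous_on_subset)
next
  case (Suc k)
  have d: "(f has_derivative frechet_derivative h (at y)) (at y)" if "y \<in> U" for y
  proof (rule has_derivative_transform_within_open)
    show "(h has_derivative frechet_derivative h (at y)) (at y)"
      using Suc.prems that by (auto simp: frechet_derivative_works[symmetric])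
  qed (use Suc.prems that in auto)
  then have eq: "frechet_derivative f (at y) = frechet_derivative h (at y)" if "y \<in> U" for y
    using frechet_derivative_at that by metis
  have "C_open k (\<lambda>y. frechet_derivative f (at y) v) U" for v
    by (rule Suc.IH[of "\<lambda>y. frechet_derivative h (at y) v"]) (use Suc.prems eq in auto)
  then show ?case
    using d by (auto simp: differentiable_def)
qed

text \<open>\<open>frechet_derivative\<close> is a choice; uniqueness of the derivative identifies
  it with whatever \<open>f'\<close> the calculus rules produce. The closure properties of C^1
  functions below rest on this.\<close>

lemma C_open_Suc_0I:
  assumes "\<And>x. x \<in> U \<Longrightarrow> (f has_derivative f' x) (at x)"
    and "\<And>v. continuous_on U (\<lambda>x. f' x v)"
  shows "C_open (Suc 0) f U"
proof -
  have "continuous_on U (\<lambda>x. frechet_derivative f (at x) v)" for v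
    using assms(2)[of v] by (rule continuous_on_eq) (metis assms(1) frechet_derivative_at)
  then show ?thesis
    using assms(1) by (auto simp: differentiable_def)
qed

lemma C_open_Suc_0D:
  assumes "C_open (Suc 0) f U" "x \<in> U"
  shows "(f has_derivative frechet_derivative f (at x)) (at x)"
  using assms by (simp add: frechet_derivative_works)

lemma C_open_Suc_0_continuous:
  assumes "C_open (Suc 0) f U"
  shows "continuous_on U f"
  using assms differentiable_at_imp_differentiable_on differentiable_imp_continuous_on
  by (metis C_open.simps(2))

lemma C_open_1_const: "C_open (Suc 0) (\<lambda>x. c) U"
  by simp

lemma C_open_1_add:
  assumes "C_open (Suc 0) f U" "C_open (Suc 0) h U"
  shows "C_open (Suc 0) (\<lambda>x. f x + h x) U"
  using assms
  by (intro C_open_Suc_0I[OF has_derivative_add]) (auto intro: C_open_Suc_0D intro!: continuous_intros)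

lemma C_open_1_mult:
  fixes f h :: "'a::real_normed_vector \<Rightarrow> real"
  assumes "C_open (Suc 0) f U" "C_open (Suc 0) h U"
  shows "C_open (Suc 0) (\<lambda>x. f x * h x) U"
  using assms C_open_Suc_0_continuous[OF assms(1)] C_open_Suc_0_continuous[OF assms(2)]
  by (intro C_open_Suc_0I[OF has_derivative_mult]) (auto intro: C_open_Suc_0D intro!: continuous_intros)

lemma C_open_1_sum:
  fixes f :: "'i \<Rightarrow> 'a::real_normed_vector \<Rightarrow> real"
  assumes "finite I" "\<And>i. i \<in> I \<Longrightarrow> C_open (Suc 0) (f i) U"
  shows "C_open (Suc 0) (\<lambda>x. \<Sum>i\<in>I. f i x) U"
  using assms
proof (induction I rule: finite_induct)
  case empty
  show ?case by simp
next
  case (insert i I)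
  have "C_open (Suc 0) (\<lambda>x. f i x + (\<Sum>i\<in>I. f i x)) U"
    using insert by (intro C_open_1_add) auto
  then show ?case using insert by (simp del: C_open.simps)
qed

lemma C_open_1_prod:
  fixes f :: "'i \<Rightarrow> 'a::real_normed_vector \<Rightarrow> real"
  assumes "finite I" "\<And>i. i \<in> I \<Longrightarrow> C_open (Suc 0) (f i) U"
  shows "C_open (Suc 0) (\<lambda>x. \<Prod>i\<in>I. f i x) U"
  using assms
proof (induction I rule: finite_induct)
  case empty
  show ?case by simp
next
  case (insert i I)
  have "C_open (Suc 0) (\<lambda>x. f i x * (\<Prod>i\<in>I. f i x)) U"
    using insert by (intro C_open_1_mult) auto
  then show ?case using insert by (simp del: C_open.simps)
qed

lemma C_open_1_compose_real:
  fixes f :: "'a::real_normed_vector \<Rightarrow> real"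
  assumes "C_open (Suc 0) f U" "\<And>x. x \<in> U \<Longrightarrow> f x \<in> T"
    and "\<And>r. r \<in> T \<Longrightarrow> (k has_real_derivative k' r) (at r)" "continuous_on T k'"
  shows "C_open (Suc 0) (\<lambda>x. k (f x)) U"
proof (rule C_open_Suc_0I)
  fix x assume x: "x \<in> U"
  have "(k has_derivative (\<lambda>h. k' (f x) * h)) (at (f x))"
    using assms(2,3) x by (simp add: has_field_derivative_def)
  from has_derivative_compose[OF C_open_Suc_0D[OF assms(1) x] this]
  show "((\<lambda>x. k (f x)) has_derivative (\<lambda>v. k' (f x) * frechet_derivative f (at x) v)) (at x)" .
next
  fix v
  have "continuous_on U (\<lambda>x. k' (f x))"
    using assms C_open_Suc_0_continuous[OF assms(1)]
    by (auto intro: continuous_on_compose2)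
  then show "continuous_on U (\<lambda>x. k' (f x) * frechet_derivative f (at x) v)"
    using assms(1) by (auto intro!: continuous_intros)
qed

lemma C_open_1_inverse:
  fixes f :: "'a::real_normed_vector \<Rightarrow> real"
  assumes "C_open (Suc 0) f U" "\<And>x. x \<in> U \<Longrightarrow> f x \<noteq> 0"
  shows "C_open (Suc 0) (\<lambda>x. inverse (f x)) U"
  by (rule C_open_1_compose_real[OF assms(1), where T = "-{0}" and k' = "\<lambda>r. - (inverse r ^ 2)"])
     (use assms in \<open>auto intro!: derivative_eq_intros continuous_intros simp: power2_eq_square\<close>)

text \<open>\<^const>\<open>sqrt\<close> is an odd function on the reals, hence smooth away from 0; so only the
  nonvanishing of \<open>det (g\<^sub>i\<^sub>j)\<close> is needed below, not its sign.\<close>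

lemma C_open_1_sqrt:
  fixes f :: "'a::real_normed_vector \<Rightarrow> real"
  assumes "C_open (Suc 0) f U" "\<And>x. x \<in> U \<Longrightarrow> f x \<noteq> 0"
  shows "C_open (Suc 0) (\<lambda>x. sqrt (f x)) U"
proof (rule C_open_1_compose_real[OF assms(1), where T = "-{0}" and k' = "\<lambda>r. inverse (sqrt \<bar>r\<bar>) / 2"])
  show "(sqrt has_real_derivative inverse (sqrt \<bar>r\<bar>) / 2) (at r)" if "r \<in> - {0}" for r
    using that by (intro DERIV_real_sqrt_generic) (auto simp: real_sqrt_minus)
qed (use assms in \<open>auto intro!: continuous_intros\<close>)

lemma C_open_1_component:
  fixes q :: "'a::real_normed_vector \<Rightarrow> real^'n::finite^'n"
  assumes "C_open (Suc 0) q U"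
  shows "C_open (Suc 0) (\<lambda>x. q x $ i $ j) U"
proof (rule C_open_Suc_0I)
  fix x assume x: "x \<in> U"
  have bl: "bounded_linear (\<lambda>m::real^'n^'n. m $ i $ j)"
    by (rule bounded_linear_compose[OF bounded_linear_vec_nth bounded_linear_vec_nth])
  show "((\<lambda>x. q x $ i $ j) has_derivative (\<lambda>v. frechet_derivative q (at x) v $ i $ j)) (at x)"
    using bounded_linear.has_derivative[OF bl C_open_Suc_0D[OF assms x]] .
qed (use assms in \<open>auto intro!: continuous_intros\<close>)

lemma C_open_1_det:
  fixes q :: "'a::real_normed_vector \<Rightarrow> real^'n::finite^'n"
  assumes "\<And>i j. C_open (Suc 0) (\<lambda>x. q x $ i $ j) U"
  shows "C_open (Suc 0) (\<lambda>x. det (q x)) U"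
  unfolding det_def
  by (intro C_open_1_sum C_open_1_mult C_open_1_prod C_open_1_const assms) auto

section \<open>Regularity of inverse matrices\<close>

lemma matrix_inv_mult:
  fixes m :: "real^'n::finite^'n"
  assumes "det m \<noteq> 0"
  shows "m ** matrix_inv m = mat 1" "matrix_inv m ** m = mat 1"
proof -
  have "\<exists>m'. m ** m' = mat 1 \<and> m' ** m = mat 1"
    using assms by (simp add: invertible_det_nz[symmetric] invertible_def)
  from someI_ex[OF this] show "m ** matrix_inv m = mat 1" "matrix_inv m ** m = mat 1"
    by (simp_all add: matrix_inv_def)
qed

text \<open>Cramer's rule applied to the equation \<open>m *v z = axis j 1\<close>. It exhibits the
  entries of the inverse as rational functions of the entries of \<open>m\<close>, so regularity of
  the metric coefficients passes to the dual metric.\<close>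

lemma matrix_inv_nth:
  fixes m :: "real^'n::finite^'n"
  assumes "det m \<noteq> 0"
  shows "matrix_inv m $ i $ j
    = det (\<chi> k l. if l = i then (if k = j then 1 else 0) else m $ k $ l) * inverse (det m)"
proof -
  have "m ** matrix_inv m = mat 1"
    by (rule matrix_inv_mult[OF assms])
  then have "m *v (matrix_inv m *v axis j 1) = axis j 1"
    by (simp add: matrix_vector_mul_assoc)
  then have "matrix_inv m *v axis j 1
      = (\<chi> i. det (\<chi> k l. if l = i then axis j 1 $ k else m $ k $ l) / det m)"
    using cramer[OF assms] by blast
  then have "(matrix_inv m *v axis j 1) $ i
      = det (\<chi> k l. if l = i then axis j 1 $ k else m $ k $ l) / det m"
    by simp
  moreover have "(\<chi> k l. if l = i then axis j 1 $ k else m $ k $ l)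
      = ((\<chi> k l. if l = i then (if k = j then 1 else 0) else m $ k $ l) :: real^'n^'n)"
    by (simp add: vec_eq_iff axis_def)
  ultimately show ?thesis
    by (simp add: matrix_vector_mult_basis column_def divide_inverse)
qed

lemma C_open_1_matrix_inv:
  fixes q :: "'a::real_normed_vector \<Rightarrow> real^'n::finite^'n"
  assumes q: "\<And>i j. C_open (Suc 0) (\<lambda>x. q x $ i $ j) U"
    and "open U" and nz: "\<And>x. x \<in> U \<Longrightarrow> det (q x) \<noteq> 0"
  shows "C_open (Suc 0) (\<lambda>x. matrix_inv (q x) $ i $ j) U"
proof (rule C_open_transform[OF _ \<open>open U\<close> order_refl matrix_inv_nth[OF nz]])
  have "C_open (Suc 0) (\<lambda>x. (\<chi> k l. if l = i then (if k = j then 1 else 0) else q x $ k $ l) $ k $ l) U"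
    for k l
    using q[of k l] by (cases "l = i") (auto simp del: C_open.simps intro: C_open_1_const)
  then show "C_open (Suc 0) (\<lambda>x. det (\<chi> k l. if l = i then (if k = j then 1 else 0) else q x $ k $ l)
      * inverse (det (q x))) U"
    by (intro C_open_1_mult C_open_1_inverse C_open_1_det q nz)
qed

text \<open>A version at a single point, for a moving frame whose continuity is known only at the
  base parameter. The determinant stays nonzero nearby, so Cramer's formula holds in a neighbourhood
  and its continuity at the point transfers to the inverse.\<close>

lemma isCont_matrix_inv_nth:
  fixes q :: "'a::t2_space \<Rightarrow> real^'n::finite^'n"
  assumes q: "\<And>i j. isCont (\<lambda>x. q x $ i $ j) x" and nz: "det (q x) \<noteq> 0"
  shows "isCont (\<lambda>x. matrix_inv (q x) $ i $ j) x"
    and "eventually (\<lambda>x. det (q x) \<noteq> 0) (nhds x)"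
proof -
  have d: "isCont (\<lambda>x. det (m x)) x" if "\<And>i j. isCont (\<lambda>x. m x $ i $ j) x"
    for m :: "'a \<Rightarrow> real^'n^'n"
    unfolding det_def by (intro continuous_intros that)
  have "filterlim (\<lambda>x. det (q x)) (nhds (det (q x))) (nhds x)"
    using d[OF q] unfolding isCont_def
    by (rule tendsto_at_iff_tendsto_nhds[where g = "\<lambda>x. det (q x)", THEN iffD1])
  then show ev: "eventually (\<lambda>x. det (q x) \<noteq> 0) (nhds x)"
    using nz by (auto dest: tendsto_imp_eventually_ne)
  have "isCont (\<lambda>x. (\<chi> k l. if l = i then (if k = j then 1 else 0) else q x $ k $ l) $ k $ l) x" for k l
    using q[of k l] by (cases "l = i") auto
  then have "isCont (\<lambda>x. det (\<chi> k l. if l = i then (if k = j then 1 else 0) else q x $ k $ l)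
      * inverse (det (q x))) x"
    by (intro continuous_mult continuous_at_within_inverse d q nz)
  then show "isCont (\<lambda>x. matrix_inv (q x) $ i $ j) x"
    by (subst isCont_cong[where g = "\<lambda>x. det (\<chi> k l. if l = i then (if k = j then 1 else 0) else q x $ k $ l)
      * inverse (det (q x))"]) (auto intro: eventually_mono[OF ev] matrix_inv_nth)
qed

section \<open>Symmetry of second derivatives\<close>

lemma mixed_second_difference:
  fixes f :: "'a::real_normed_vector \<Rightarrow> real"
  assumes U: "\<And>r q. 0 \<le> r \<Longrightarrow> r \<le> s \<Longrightarrow> 0 \<le> q \<Longrightarrow> q \<le> s \<Longrightarrow> x + r *\<^sub>R u + q *\<^sub>R v \<in> U"
    and f: "\<And>y. y \<in> U \<Longrightarrow> (f has_derivative d y) (at y)"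
    and d: "\<And>y. y \<in> U \<Longrightarrow> ((\<lambda>y. d y u) has_derivative d2 y) (at y)"
    and s: "0 < s"
  shows "\<exists>r q. 0 \<le> r \<and> r \<le> s \<and> 0 \<le> q \<and> q \<le> s \<and>
    f (x + s *\<^sub>R u + s *\<^sub>R v) - f (x + s *\<^sub>R u) - f (x + s *\<^sub>R v) + f x
      = s * s * d2 (x + r *\<^sub>R u + q *\<^sub>R v) v"
proof -
  have 1: "((\<lambda>r. f (x + r *\<^sub>R u + q *\<^sub>R v)) has_real_derivative d (x + r *\<^sub>R u + q *\<^sub>R v) u) (at r)"
    if "0 \<le> r" "r \<le> s" "0 \<le> q" "q \<le> s" for r q
  proof -
    have *: "((\<lambda>r. x + r *\<^sub>R u + q *\<^sub>R v) has_derivative (\<lambda>h. h *\<^sub>R u)) (at r)"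
      by (auto intro!: derivative_eq_intros)
    have "linear (d (x + r *\<^sub>R u + q *\<^sub>R v))"
      using f[OF U[OF that]] has_derivative_linear by blast
    then show ?thesis
      using has_derivative_compose[OF * f[OF U[OF that]]]
      by (simp add: has_field_derivative_def linear_scale mult.commute[of _ "d _ _"])
  qed
  \<comment> \<open>The second difference is the increment of \<open>g\<close> over [0, s]. The mean
    value theorem in direction \<open>u\<close> turns it into a difference of first derivatives, and
    a second use in direction \<open>v\<close> turns that into a second derivative.\<close>
  define g where "g = (\<lambda>r. f (x + r *\<^sub>R u + s *\<^sub>R v) - f (x + r *\<^sub>R u))"
  have "(g has_real_derivative d (x + r *\<^sub>R u + s *\<^sub>R v) u - d (x + r *\<^sub>R u) u) (at r)"
    if "0 \<le> r" "r \<le> s" for r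
    unfolding g_def using 1[OF that, of s] 1[OF that, of 0] s by (intro DERIV_diff) auto
  from MVT2[OF s this] obtain r where r: "0 < r" "r < s"
    "g s - g 0 = s * (d (x + r *\<^sub>R u + s *\<^sub>R v) u - d (x + r *\<^sub>R u) u)"
    by auto
  have 2: "((\<lambda>q. d (x + r *\<^sub>R u + q *\<^sub>R v) u) has_real_derivative d2 (x + r *\<^sub>R u + q *\<^sub>R v) v) (at q)"
    if "0 \<le> q" "q \<le> s" for q
  proof -
    have U': "x + r *\<^sub>R u + q *\<^sub>R v \<in> U" using U that r by auto
    have *: "((\<lambda>q. x + r *\<^sub>R u + q *\<^sub>R v) has_derivative (\<lambda>h. h *\<^sub>R v)) (at q)"
      by (auto intro!: derivative_eq_intros)
    have "linear (d2 (x + r *\<^sub>R u + q *\<^sub>R v))"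
      using d[OF U'] has_derivative_linear by blast
    then show ?thesis
      using has_derivative_compose[OF * d[OF U']]
      by (simp add: has_field_derivative_def linear_scale mult.commute[of _ "d2 _ _"])
  qed
  from MVT2[OF s this] obtain q where q: "0 < q" "q < s"
    "d (x + r *\<^sub>R u + s *\<^sub>R v) u - d (x + r *\<^sub>R u) u = s * d2 (x + r *\<^sub>R u + q *\<^sub>R v) v"
    by auto
  have "g s - g 0 = f (x + s *\<^sub>R u + s *\<^sub>R v) - f (x + s *\<^sub>R u) - f (x + s *\<^sub>R v) + f x"
    by (simp add: g_def)
  with r q show ?thesis
    by (intro exI[of _ r] exI[of _ q]) auto
qed

text \<open>The second difference is unchanged when \<open>u\<close> and \<open>v\<close> are
  exchanged. By \<open>mixed_second_difference\<close> it equals s^2 times either mixed derivative,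
  each at some point near \<open>x\<close>; continuity at \<open>x\<close> then forces the two
  values to agree.\<close>

lemma second_derivative_symmetric:
  fixes f :: "'a::real_normed_vector \<Rightarrow> real"
  assumes "open U" "x \<in> U"
    and f: "\<And>y. y \<in> U \<Longrightarrow> (f has_derivative d y) (at y)"
    and du: "\<And>y. y \<in> U \<Longrightarrow> ((\<lambda>y. d y u) has_derivative du y) (at y)"
    and dv: "\<And>y. y \<in> U \<Longrightarrow> ((\<lambda>y. d y v) has_derivative dv y) (at y)"
    and cont: "isCont (\<lambda>y. du y v) x" "isCont (\<lambda>y. dv y u) x"
  shows "du x v = dv x u"
proof (rule ccontr)
  assume "du x v \<noteq> dv x u"
  \<comment> \<open>Half of the supposed gap: a common value within less than \<open>e\<close> of
    both derivatives is impossible.\<close>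
  define e where "e = \<bar>du x v - dv x u\<bar> / 2"
  have "e > 0" using \<open>du x v \<noteq> dv x u\<close> by (simp add: e_def)
  obtain \<delta>1 where \<delta>1: "\<delta>1 > 0" "\<And>y. dist y x < \<delta>1 \<Longrightarrow> dist (du y v) (du x v) < e"
    using cont(1) \<open>e > 0\<close> unfolding continuous_at_eps_delta by blast
  obtain \<delta>2 where \<delta>2: "\<delta>2 > 0" "\<And>y. dist y x < \<delta>2 \<Longrightarrow> dist (dv y u) (dv x u) < e"
    using cont(2) \<open>e > 0\<close> unfolding continuous_at_eps_delta by blast
  obtain \<delta>3 where \<delta>3: "\<delta>3 > 0" "ball x \<delta>3 \<subseteq> U"
    using assms(1,2) open_contains_ball by blast
  define \<delta> where "\<delta> = min \<delta>1 (min \<delta>2 \<delta>3)"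
  \<comment> \<open>Keeps the whole parallelogram with sides \<open>s u\<close> and
    \<open>s v\<close> within distance \<delta> of \<open>x\<close>; the summand 1 keeps the
    denominator positive when both vectors vanish.\<close>
  define s where "s = \<delta> / (1 + norm u + norm v)"
  have pos: "1 + norm u + norm v > 0"
    by (simp add: add_pos_nonneg)
  have \<delta>: "\<delta> > 0" and s: "s > 0"
    using \<delta>1 \<delta>2 \<delta>3 pos by (auto simp: \<delta>_def s_def)
  have near: "dist (x + r *\<^sub>R u + q *\<^sub>R v) x < \<delta>" if "0 \<le> r" "r \<le> s" "0 \<le> q" "q \<le> s" for r q
  proof -
    have "dist (x + r *\<^sub>R u + q *\<^sub>R v) x = norm (r *\<^sub>R u + q *\<^sub>R v)"
      by (simp add: dist_norm algebra_simps)
    also have "\<dots> \<le> r * norm u + q * norm v"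
      using that by (metis abs_of_nonneg norm_scaleR norm_triangle_ineq)
    also have "\<dots> \<le> s * norm u + s * norm v"
      using that by (intro add_mono mult_right_mono) auto
    also have "\<dots> < s * (1 + norm u + norm v)"
      using s by (simp add: algebra_simps)
    also have "\<dots> = \<delta>" using pos by (simp add: s_def)
    finally show ?thesis .
  qed
  then have inU: "x + r *\<^sub>R u + q *\<^sub>R v \<in> U" if "0 \<le> r" "r \<le> s" "0 \<le> q" "q \<le> s" for r q
    using that \<delta>3 by (force simp: \<delta>_def dist_commute)
  obtain r q where 1: "0 \<le> r" "r \<le> s" "0 \<le> q" "q \<le> s"
    "f (x + s *\<^sub>R u + s *\<^sub>R v) - f (x + s *\<^sub>R u) - f (x + s *\<^sub>R v) + f x
      = s * s * du (x + r *\<^sub>R u + q *\<^sub>R v) v"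
    using mixed_second_difference[OF inU f du s] by blast
  have inU': "x + r *\<^sub>R v + q *\<^sub>R u \<in> U" if "0 \<le> r" "r \<le> s" "0 \<le> q" "q \<le> s" for r q
    using inU[of q r] that by (simp add: algebra_simps)
  obtain r' q' where 2: "0 \<le> r'" "r' \<le> s" "0 \<le> q'" "q' \<le> s"
    "f (x + s *\<^sub>R v + s *\<^sub>R u) - f (x + s *\<^sub>R v) - f (x + s *\<^sub>R u) + f x
      = s * s * dv (x + r' *\<^sub>R v + q' *\<^sub>R u) u"
    using mixed_second_difference[OF inU' f dv s] by blast
  have "s * s * du (x + r *\<^sub>R u + q *\<^sub>R v) v = s * s * dv (x + q' *\<^sub>R u + r' *\<^sub>R v) u"
    using 1(5) 2(5) by (simp add: algebra_simps)
  then have "du (x + r *\<^sub>R u + q *\<^sub>R v) v = dv (x + q' *\<^sub>R u + r' *\<^sub>R v) u"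
    using s by simp
  moreover have "dist (du (x + r *\<^sub>R u + q *\<^sub>R v) v) (du x v) < e"
    using near[OF 1(1-4)] by (intro \<delta>1) (simp add: \<delta>_def)
  moreover have "dist (dv (x + q' *\<^sub>R u + r' *\<^sub>R v) u) (dv x u) < e"
    using near[OF 2(3,4,1,2)] by (intro \<delta>2) (simp add: \<delta>_def)
  moreover have "\<bar>p - q\<bar> \<le> \<bar>a - p\<bar> + \<bar>a - q\<bar>" for a p q :: real
    by linarith
  ultimately show False
    unfolding e_def dist_real_def by (smt (verit) field_sum_of_halves)
qed

section \<open>The differential inequality along a transversal curve\<close>

text \<open>The energy \<open>e\<close> = W^2 + W1^2 satisfies |e'| \<le> K e. Hence e exp(-K t) is
  nonincreasing and e exp(K t) is nondecreasing, and the zero of the energy at \<open>s\<close>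
  spreads to the right by the first and to the left by the second.\<close>

lemma second_order_gronwall:
  fixes W W1 W2 :: "real \<Rightarrow> real"
  assumes W: "\<And>t. t \<in> {a<..<b} \<Longrightarrow> (W has_real_derivative W1 t) (at t)"
    and W1: "\<And>t. t \<in> {a<..<b} \<Longrightarrow> (W1 has_real_derivative W2 t) (at t)"
    and bound: "\<And>t. t \<in> {a<..<b} \<Longrightarrow> \<bar>W2 t\<bar> \<le> C * (\<bar>W t\<bar> + \<bar>W1 t\<bar>)"
    and s: "s \<in> {a<..<b}" "W s = 0" "W1 s = 0"
    and t: "t \<in> {a<..<b}"
  shows "W t = 0"
proof -
  define e where "e t = (W t)\<^sup>2 + (W1 t)\<^sup>2" for t
  define e' where "e' t = 2 * W t * W1 t + 2 * W1 t * W2 t" for t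
  \<comment> \<open>Here 2 |W W1| \<le> e contributes the 1, and 2 |W1 W2| \<le> 2 |C| (|W W1| +
    W1^2) \<le> 3 |C| e contributes the rest. The absolute value covers a \<open>C\<close> of either
    sign.\<close>
  define K where "K = 1 + 3 * \<bar>C\<bar>"
  have e: "(e has_real_derivative e' t) (at t)" if "t \<in> {a<..<b}" for t
    unfolding e_def e'_def
    by (rule derivative_eq_intros W W1 that refl | simp add: algebra_simps)+
  have e'_le: "\<bar>e' t\<bar> \<le> K * e t" if "t \<in> {a<..<b}" for t
  proof -
    define x y z where "x = \<bar>W t\<bar>" and "y = \<bar>W1 t\<bar>" and "z = \<bar>W2 t\<bar>"
    have pos: "0 \<le> x" "0 \<le> y" "0 \<le> z" by (auto simp: x_def y_def z_def)
    have "z \<le> C * (x + y)" using bound[OF that] by (simp add: x_def y_def z_def)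
    also have "\<dots> \<le> \<bar>C\<bar> * (x + y)" using pos by (intro mult_right_mono) auto
    finally have "y * z \<le> y * (\<bar>C\<bar> * (x + y))" using pos by (intro mult_left_mono) auto
    also have "\<dots> = \<bar>C\<bar> * (x * y + y\<^sup>2)"
      by (simp add: algebra_simps power2_eq_square)
    finally have 1: "y * z \<le> \<bar>C\<bar> * (x * y + y\<^sup>2)" .
    have 2: "2 * (x * y) \<le> x\<^sup>2 + y\<^sup>2"
      using sum_squares_bound[of x y] by simp
    have "2 * (x * y + y\<^sup>2) \<le> 3 * (x\<^sup>2 + y\<^sup>2)" using 2 zero_le_power2[of x] by (simp only: distrib_left)
    then have "\<bar>C\<bar> * (2 * (x * y + y\<^sup>2)) \<le> \<bar>C\<bar> * (3 * (x\<^sup>2 + y\<^sup>2))"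
      by (rule mult_left_mono) simp
    then have 3: "2 * (y * z) \<le> 3 * \<bar>C\<bar> * (x\<^sup>2 + y\<^sup>2)" using 1 by (simp add: algebra_simps)
    have "\<bar>e' t\<bar> \<le> 2 * (x * y) + 2 * (y * z)"
      unfolding e'_def x_def y_def z_def
      using abs_triangle_ineq[of "2 * W t * W1 t" "2 * W1 t * W2 t"] by (simp add: abs_mult)
    also have "\<dots> \<le> K * (x\<^sup>2 + y\<^sup>2)" using 2 3 by (simp add: K_def algebra_simps)
    finally show ?thesis by (simp add: e_def x_def y_def)
  qed
  have "e s = 0" using s by (simp add: e_def)
  have "e t \<le> 0"
  proof (cases "s \<le> t")
    case True
    have "e t * exp (- K * t) \<le> e s * exp (- K * s)"
    proof (rule DERIV_nonpos_imp_nonincreasing[OF True, where f = "\<lambda>t. e t * exp (- K * t)"])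
      fix r assume "s \<le> r" "r \<le> t"
      then have r: "r \<in> {a<..<b}" using s t by auto
      have "((\<lambda>t. e t * exp (- K * t)) has_real_derivative (e' r - K * e r) * exp (- K * r)) (at r)"
        by (rule derivative_eq_intros e r refl | simp add: algebra_simps)+
      moreover have "(e' r - K * e r) * exp (- K * r) \<le> 0"
        using e'_le[OF r] by (intro mult_nonpos_nonneg) auto
      ultimately show "\<exists>y. ((\<lambda>t. e t * exp (- K * t)) has_real_derivative y) (at r) \<and> y \<le> 0" by blast
    qed
    then show ?thesis using \<open>e s = 0\<close> by (simp add: mult_le_0_iff not_le[symmetric])
  next
    case False
    have "e t * exp (K * t) \<le> e s * exp (K * s)"
    proof (rule DERIV_nonneg_imp_nondecreasing[where f = "\<lambda>t. e t * exp (K * t)"])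
      show "t \<le> s" using False by simp
      fix r assume "t \<le> r" "r \<le> s"
      then have r: "r \<in> {a<..<b}" using s t by auto
      have "((\<lambda>t. e t * exp (K * t)) has_real_derivative (e' r + K * e r) * exp (K * r)) (at r)"
        by (rule derivative_eq_intros e r refl | simp add: algebra_simps)+
      moreover have "0 \<le> (e' r + K * e r) * exp (K * r)"
        using e'_le[OF r] by (intro mult_nonneg_nonneg) auto
      ultimately show "\<exists>y. ((\<lambda>t. e t * exp (K * t)) has_real_derivative y) (at r) \<and> 0 \<le> y" by blast
    qed
    then show ?thesis using \<open>e s = 0\<close> by (simp add: mult_le_0_iff not_le[symmetric])
  qed
  then show ?thesis by (simp add: e_def sum_power2_le_zero_iff)
qed

text \<open>Linear algebra at one point: \<open>D\<close> and \<open>H\<close> stand for gradient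
  and Hessian, the \<open>Y i\<close> for orbit directions, and \<sigma>1, \<sigma>2 for velocity
  and acceleration of the curve. Pairing the frame relation with \<open>D\<close> leaves D = W1
  \<eta>. The hypothesis on \<open>Z\<close> trades every Hessian entry with an argument
  \<open>Y i\<close> for a first-order term, hence a multiple of \<open>W1\<close>, so
  \<open>W2\<close> carries all that remains of second order.\<close>

lemma frame_second_order:
  fixes D \<sigma>1 \<sigma>2 b \<eta> :: "real^'n::finite" and H Q :: "real^'n^'n"
    and Y :: "'n \<Rightarrow> real^'n" and Z :: "'n \<Rightarrow> real^'n \<Rightarrow> real^'n"
  assumes sym: "transpose H = H"
    and Y: "\<And>i. D \<bullet> Y i = 0"
    and Z: "\<And>i z. (H *v z) \<bullet> Y i + D \<bullet> Z i z = 0"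
    and frame: "\<And>i. axis i 1 = \<eta> $ i *\<^sub>R \<sigma>1 + Y i"
    and W1: "W1 = D \<bullet> \<sigma>1" and W2: "W2 = (H *v \<sigma>1) \<bullet> \<sigma>1 + D \<bullet> \<sigma>2"
  shows "(\<Sum>i\<in>UNIV. \<Sum>j\<in>UNIV. Q $ i $ j * H $ i $ j) + b \<bullet> D
    = W2 * (\<Sum>i\<in>UNIV. \<Sum>j\<in>UNIV. Q $ i $ j * (\<eta> $ i * \<eta> $ j))
      + W1 * (b \<bullet> \<eta> - (\<Sum>i\<in>UNIV. \<Sum>j\<in>UNIV. Q $ i $ j *
          (\<eta> $ i * \<eta> $ j * (\<eta> \<bullet> \<sigma>2) + \<eta> $ i * (\<eta> \<bullet> Z j \<sigma>1) + \<eta> \<bullet> Z i (axis j 1))))"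
proof -
  have D: "D = W1 *\<^sub>R \<eta>"
  proof (rule vec_eq_iff[THEN iffD2], rule allI)
    fix i
    have "D $ i = D \<bullet> axis i 1" by (simp add: inner_axis)
    also have "\<dots> = \<eta> $ i * (D \<bullet> \<sigma>1)"
      by (subst frame) (simp add: inner_add_right Y)
    finally show "D $ i = (W1 *\<^sub>R \<eta>) $ i" by (simp add: W1)
  qed
  have sym': "(H *v u) \<bullet> v = (H *v v) \<bullet> u" for u v
    by (metis dot_lmul_matrix inner_commute sym vector_transpose_matrix)
  have H: "H $ i $ j = \<eta> $ i * \<eta> $ j * W2 - W1 *
      (\<eta> $ i * \<eta> $ j * (\<eta> \<bullet> \<sigma>2) + \<eta> $ i * (\<eta> \<bullet> Z j \<sigma>1) + \<eta> \<bullet> Z i (axis j 1))" for i j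
  proof -
    \<comment> \<open>The index \<open>i\<close> is expanded in the frame first; symmetry of
      \<open>H\<close> then exposes the index \<open>j\<close> in the factor paired with \<sigma>1,
      and it is expanded in turn.\<close>
    have "H $ i $ j = (H *v axis j 1) \<bullet> axis i 1"
      by (simp add: matrix_vector_mult_basis column_def inner_axis)
    also have "\<dots> = \<eta> $ i * ((H *v axis j 1) \<bullet> \<sigma>1) + (H *v axis j 1) \<bullet> Y i"
      by (subst (2) frame) (simp add: inner_add_right)
    also have "(H *v axis j 1) \<bullet> Y i = - (D \<bullet> Z i (axis j 1))"
      using Z[of "axis j 1" i] by simp
    also have "(H *v axis j 1) \<bullet> \<sigma>1 = (H *v \<sigma>1) \<bullet> axis j 1"
      by (rule sym')
    also have "(H *v \<sigma>1) \<bullet> axis j 1 = \<eta> $ j * ((H *v \<sigma>1) \<bullet> \<sigma>1) + (H *v \<sigma>1) \<bullet> Y j"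
      by (subst frame) (simp add: inner_add_right)
    also have "(H *v \<sigma>1) \<bullet> Y j = - (D \<bullet> Z j \<sigma>1)"
      using Z[of \<sigma>1 j] by simp
    also have "(H *v \<sigma>1) \<bullet> \<sigma>1 = W2 - D \<bullet> \<sigma>2"
      by (simp add: W2)
    finally show ?thesis by (simp add: D algebra_simps)
  qed
  show ?thesis
    unfolding H D
    by (simp add: sum_distrib_left sum_subtractf algebra_simps sum.distrib)
qed

text \<open>The frame relation is given only at \<open>t0\<close>. Nearby, the frame is a small
  perturbation of the standard basis and is inverted; its coefficients are continuous at
  \<open>t0\<close>, so \<open>frame_second_order\<close> gives a differential inequality with
  constants uniform on a ball. The conclusion allows the zero of first order at any \<open>s\<close>
  in the ball, not only at its centre, which the later closedness argument relies on.\<close>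

lemma radial_unique_continuation:
  fixes w :: "real^'n::finite \<Rightarrow> real" and D b :: "real^'n \<Rightarrow> real^'n" and H Q :: "real^'n \<Rightarrow> real^'n^'n"
    and X :: "'n \<Rightarrow> real^'n \<Rightarrow> real^'n" and DX :: "'n \<Rightarrow> real^'n \<Rightarrow> real^'n \<Rightarrow> real^'n"
    and \<sigma> \<sigma>1 \<sigma>2 :: "real \<Rightarrow> real^'n" and a :: "real^'n"
  assumes "open \<Omega>" "\<sigma> t0 \<in> \<Omega>" "open T" "t0 \<in> T"
    and w: "\<And>y. y \<in> \<Omega> \<Longrightarrow> (w has_derivative (\<lambda>v. D y \<bullet> v)) (at y)"
    and D: "\<And>y. y \<in> \<Omega> \<Longrightarrow> (D has_derivative (\<lambda>z. H y *v z)) (at y)"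
    and sym: "\<And>y. y \<in> \<Omega> \<Longrightarrow> transpose (H y) = H y"
    and X: "\<And>k y. y \<in> \<Omega> \<Longrightarrow> (X k has_derivative DX k y) (at y)"
    and DX: "\<And>k v. isCont (\<lambda>y. DX k y v) (\<sigma> t0)"
    and tangent: "\<And>k y. y \<in> \<Omega> \<Longrightarrow> D y \<bullet> X k y = 0"
    and \<sigma>: "\<And>t. t \<in> T \<Longrightarrow> (\<sigma> has_vector_derivative \<sigma>1 t) (at t)"
    and \<sigma>1: "\<And>t. t \<in> T \<Longrightarrow> (\<sigma>1 has_vector_derivative \<sigma>2 t) (at t)"
    and \<sigma>2: "isCont \<sigma>2 t0"
    and frame: "\<And>k. axis k 1 = a $ k *\<^sub>R \<sigma>1 t0 + X k (\<sigma> t0)" and "a \<noteq> 0"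
    and Q: "\<And>i j. isCont (\<lambda>y. Q y $ i $ j) (\<sigma> t0)"
    and Q_pos: "\<And>v. v \<noteq> 0 \<Longrightarrow> 0 < (\<Sum>i\<in>UNIV. \<Sum>j\<in>UNIV. Q (\<sigma> t0) $ i $ j * (v $ i * v $ j))"
    and b: "isCont b (\<sigma> t0)"
    and bound: "\<And>y. y \<in> \<Omega> \<Longrightarrow>
      \<bar>(\<Sum>i\<in>UNIV. \<Sum>j\<in>UNIV. Q y $ i $ j * H y $ i $ j) + b y \<bullet> D y\<bar> \<le> C * \<bar>w y\<bar>"
  shows "\<exists>\<epsilon>>0. \<forall>s\<in>ball t0 \<epsilon>. w (\<sigma> s) = 0 \<longrightarrow> D (\<sigma> s) \<bullet> \<sigma>1 s = 0 \<longrightarrow> (\<forall>t\<in>ball t0 \<epsilon>. w (\<sigma> t) = 0)"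
proof -
  \<comment> \<open>The rows of \<open>R t\<close> are the frame vectors transported along the
    curve, so \<open>R t0\<close> is the identity. Multiplying by the inverse \<open>P t\<close>
    recovers the standard basis, with curve components \<open>\<eta> t\<close> and orbit components
    \<open>Y t\<close>.\<close>
  define R where "R t = (\<chi> k. a $ k *\<^sub>R \<sigma>1 t + X k (\<sigma> t))" for t
  define P where "P t = matrix_inv (R t)" for t
  define \<eta> where "\<eta> t = P t *v a" for t
  define Y where "Y t i = (\<Sum>k\<in>UNIV. P t $ i $ k *\<^sub>R X k (\<sigma> t))" for t i
  \<comment> \<open>The matrix \<open>P t\<close> is held fixed and only the fields
    \<open>X k\<close> are differentiated, since each product of \<open>D\<close> with
    \<open>X k\<close> vanishes by itself. Expanding \<open>z\<close> in the basis lets continuity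
    of \<open>DX k y v\<close> for fixed \<open>v\<close> suffice.\<close>
  define Z where "Z t i z = (\<Sum>l\<in>UNIV. z $ l *\<^sub>R (\<Sum>k\<in>UNIV. P t $ i $ k *\<^sub>R DX k (\<sigma> t) (axis l 1)))" for t i z
  define \<kappa> where "\<kappa> t = (\<Sum>i\<in>UNIV. \<Sum>j\<in>UNIV. Q (\<sigma> t) $ i $ j * (\<eta> t $ i * \<eta> t $ j))" for t
  define m where "m t = b (\<sigma> t) \<bullet> \<eta> t - (\<Sum>i\<in>UNIV. \<Sum>j\<in>UNIV. Q (\<sigma> t) $ i $ j *
          (\<eta> t $ i * \<eta> t $ j * (\<eta> t \<bullet> \<sigma>2 t) + \<eta> t $ i * (\<eta> t \<bullet> Z t j (\<sigma>1 t)) + \<eta> t \<bullet> Z t i (axis j 1)))" for t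
  define W1 where "W1 t = D (\<sigma> t) \<bullet> \<sigma>1 t" for t
  define W2 where "W2 t = (H (\<sigma> t) *v \<sigma>1 t) \<bullet> \<sigma>1 t + D (\<sigma> t) \<bullet> \<sigma>2 t" for t
  have c\<sigma>: "isCont \<sigma> t0" "isCont \<sigma>1 t0"
    using \<sigma>[OF \<open>t0 \<in> T\<close>] \<sigma>1[OF \<open>t0 \<in> T\<close>] by (auto intro: has_vector_derivative_continuous)
  have cX: "isCont (\<lambda>t. X k (\<sigma> t)) t0" for k
    by (rule isCont_o2[OF c\<sigma>(1)]) (rule has_derivative_continuous[OF X[OF \<open>\<sigma> t0 \<in> \<Omega>\<close>]])
  have cDX: "isCont (\<lambda>t. DX k (\<sigma> t) v) t0" for k v
    by (rule isCont_o2[OF c\<sigma>(1) DX])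
  have cR: "isCont (\<lambda>t. R t $ i $ j) t0" for i j
    using c\<sigma>(2) cX by (auto simp: R_def intro!: continuous_intros)
  have R0: "R t0 = mat 1"
    by (auto simp: R_def frame[symmetric] vec_eq_iff mat_def axis_def)
  have P0: "P t0 = mat 1"
    using matrix_inv_mult(1)[of "mat 1 :: real^'n^'n"] by (simp add: P_def R0)
  have cP: "isCont (\<lambda>t. P t $ i $ j) t0" for i j
    unfolding P_def by (rule isCont_matrix_inv_nth(1)[OF cR]) (simp add: R0)
  have ev_det: "eventually (\<lambda>t. det (R t) \<noteq> 0) (nhds t0)"
    by (rule isCont_matrix_inv_nth(2)[OF cR]) (simp add: R0)
  have cQ: "isCont (\<lambda>t. Q (\<sigma> t) $ i $ j) t0" for i j
    by (rule isCont_o2[OF c\<sigma>(1) Q])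
  have c\<eta>: "isCont \<eta> t0"
    unfolding \<eta>_def matrix_vector_mult_def isCont_def
    by (intro tendsto_vec_lambda tendsto_intros cP[unfolded isCont_def])
  have cb: "isCont (\<lambda>t. b (\<sigma> t)) t0"
    by (rule isCont_o2[OF c\<sigma>(1) b])
  have cZ: "isCont (\<lambda>t. Z t i (z t)) t0" if "isCont z t0" for i z
    unfolding Z_def by (intro continuous_intros cP cDX that)
  have c\<kappa>: "isCont \<kappa> t0"
    unfolding \<kappa>_def by (intro continuous_intros cQ c\<eta>)
  have cm: "isCont m t0"
    unfolding m_def by (intro continuous_intros cQ c\<eta> cb \<sigma>2 cZ c\<sigma>)
  \<comment> \<open>At \<open>t0\<close> the matrix \<open>P\<close> is the identity, so
    \<open>\<eta> t0\<close> is the nonzero vector \<open>a\<close> and positivity of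
    \<open>Q\<close> applies.\<close>
  have "\<kappa> t0 > 0"
    using Q_pos[OF \<open>a \<noteq> 0\<close>] by (simp add: \<kappa>_def \<eta>_def P0)
  have tends: "(h \<longlongrightarrow> h t0) (nhds t0)" if "isCont h t0" for h :: "real \<Rightarrow> 'c::topological_space"
    using that unfolding isCont_def by (rule tendsto_at_iff_tendsto_nhds[THEN iffD1])
  have "eventually (\<lambda>t. t \<in> T \<and> \<sigma> t \<in> \<Omega> \<and> det (R t) \<noteq> 0 \<and> \<kappa> t > \<kappa> t0 / 2 \<and> \<bar>m t\<bar> < \<bar>m t0\<bar> + 1) (nhds t0)"
  proof (intro eventually_conj ev_det)
    show "eventually (\<lambda>t. t \<in> T) (nhds t0)" using assms by (simp add: eventually_nhds_in_open)
    show "eventually (\<lambda>t. \<sigma> t \<in> \<Omega>) (nhds t0)"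
      using topological_tendstoD[OF tends[OF c\<sigma>(1)]] assms by blast
    show "eventually (\<lambda>t. \<kappa> t > \<kappa> t0 / 2) (nhds t0)"
      by (rule order_tendstoD(1)[OF tends[OF c\<kappa>]]) (use \<open>\<kappa> t0 > 0\<close> in simp)
    show "eventually (\<lambda>t. \<bar>m t\<bar> < \<bar>m t0\<bar> + 1) (nhds t0)"
      using order_tendstoD(2)[OF tendsto_rabs[OF tends[OF cm]]] by simp
  qed
  then obtain \<epsilon> where "\<epsilon> > 0" and \<epsilon>: "\<And>t. t \<in> ball t0 \<epsilon> \<Longrightarrow>
      t \<in> T \<and> \<sigma> t \<in> \<Omega> \<and> det (R t) \<noteq> 0 \<and> \<kappa> t > \<kappa> t0 / 2 \<and> \<bar>m t\<bar> < \<bar>m t0\<bar> + 1"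
    unfolding eventually_nhds_metric by (auto simp: dist_commute)
  have eq: "(\<Sum>i\<in>UNIV. \<Sum>j\<in>UNIV. Q (\<sigma> t) $ i $ j * H (\<sigma> t) $ i $ j) + b (\<sigma> t) \<bullet> D (\<sigma> t)
      = W2 t * \<kappa> t + W1 t * m t" if t: "t \<in> ball t0 \<epsilon>" for t
    unfolding \<kappa>_def m_def
  proof (rule frame_second_order[where Y = "Y t"])
    have in\<Omega>: "\<sigma> t \<in> \<Omega>" and det: "det (R t) \<noteq> 0" using \<epsilon>[OF t] by auto
    show "transpose (H (\<sigma> t)) = H (\<sigma> t)" by (rule sym[OF in\<Omega>])
    show "D (\<sigma> t) \<bullet> Y t i = 0" for i
      by (simp add: Y_def inner_sum_right tangent[OF in\<Omega>])
    show "(H (\<sigma> t) *v z) \<bullet> Y t i + D (\<sigma> t) \<bullet> Z t i z = 0" for i z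
    proof -
      \<comment> \<open>This is the derivative in direction \<open>z\<close> of the product of
        \<open>D\<close> and \<open>X k\<close>, which vanishes identically on the open set
        \<Omega>.\<close>
      have 1: "(H (\<sigma> t) *v z) \<bullet> X k (\<sigma> t) + D (\<sigma> t) \<bullet> DX k (\<sigma> t) z = 0" for k
      proof -
        have "((\<lambda>y. D y \<bullet> X k y) has_derivative
            (\<lambda>z. D (\<sigma> t) \<bullet> DX k (\<sigma> t) z + (H (\<sigma> t) *v z) \<bullet> X k (\<sigma> t))) (at (\<sigma> t))"
          by (rule has_derivative_inner[OF D[OF in\<Omega>] X[OF in\<Omega>]])
        moreover have "((\<lambda>y. D y \<bullet> X k y) has_derivative (\<lambda>z. 0)) (at (\<sigma> t))"
          by (rule has_derivative_transform_within_open[OF has_derivative_const[of 0] \<open>open \<Omega>\<close> in\<Omega>])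
             (simp add: tangent)
        ultimately show ?thesis
          using has_derivative_unique by (metis (no_types, lifting) add.commute)
      qed
      have lin: "linear (DX k (\<sigma> t))" for k
        using X[OF in\<Omega>] has_derivative_linear by blast
      have "DX k (\<sigma> t) z = (\<Sum>l\<in>UNIV. z $ l *\<^sub>R DX k (\<sigma> t) (axis l 1))" for k
        by (subst basis_expansion[of z, symmetric])
           (simp add: linear_sum[OF lin] linear_scale[OF lin] scalar_mult_eq_scaleR)
      then have "(\<Sum>k\<in>UNIV. P t $ i $ k *\<^sub>R DX k (\<sigma> t) z)
          = (\<Sum>k\<in>UNIV. \<Sum>l\<in>UNIV. P t $ i $ k *\<^sub>R z $ l *\<^sub>R DX k (\<sigma> t) (axis l 1))"
        by (simp add: scaleR_right.sum)
      also have "\<dots> = Z t i z"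
        unfolding Z_def scaleR_right.sum by (subst sum.swap) (simp add: mult.commute)
      finally have Z: "Z t i z = (\<Sum>k\<in>UNIV. P t $ i $ k *\<^sub>R DX k (\<sigma> t) z)" ..
      have "(H (\<sigma> t) *v z) \<bullet> Y t i + D (\<sigma> t) \<bullet> Z t i z
          = (\<Sum>k\<in>UNIV. P t $ i $ k * ((H (\<sigma> t) *v z) \<bullet> X k (\<sigma> t) + D (\<sigma> t) \<bullet> DX k (\<sigma> t) z))"
        by (simp add: Y_def Z inner_sum_right sum.distrib distrib_left)
      then show ?thesis by (simp add: 1)
    qed
    show "axis i 1 = \<eta> t $ i *\<^sub>R \<sigma>1 t + Y t i" for i
    proof -
      have "axis i 1 = (P t ** R t) $ i"
        using matrix_inv_mult(2)[OF det] by (simp add: P_def mat_def axis_def vec_eq_iff)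
      also have "\<dots> = (\<Sum>k\<in>UNIV. P t $ i $ k *\<^sub>R R t $ k)"
        by (simp add: matrix_matrix_mult_def vec_eq_iff)
      also have "\<dots> = \<eta> t $ i *\<^sub>R \<sigma>1 t + Y t i"
        by (simp add: R_def \<eta>_def Y_def matrix_vector_mult_def scaleR_right_distrib sum.distrib scaleR_sum_left)
      finally show ?thesis .
    qed
    show "W1 t = D (\<sigma> t) \<bullet> \<sigma>1 t" "W2 t = (H (\<sigma> t) *v \<sigma>1 t) \<bullet> \<sigma>1 t + D (\<sigma> t) \<bullet> \<sigma>2 t"
      by (simp_all add: W1_def W2_def)
  qed
  \<comment> \<open>Solving the identity for \<open>W2\<close> means dividing by
    \<open>\<kappa> t\<close>, which is at least \<open>\<kappa> t0 / 2\<close> on the ball. The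
    numerator bounds both the Lipschitz factor and the coefficient \<open>m t\<close> of
    \<open>W1\<close>.\<close>
  define K where "K = (\<bar>C\<bar> + (\<bar>m t0\<bar> + 1)) / (\<kappa> t0 / 2)"
  have W2_le: "\<bar>W2 t\<bar> \<le> K * (\<bar>w (\<sigma> t)\<bar> + \<bar>W1 t\<bar>)" if t: "t \<in> ball t0 \<epsilon>" for t
  proof -
    have "\<bar>W2 t\<bar> * (\<kappa> t0 / 2) \<le> \<bar>W2 t\<bar> * \<kappa> t"
      using \<epsilon>[OF t] by (intro mult_left_mono) auto
    also have "\<dots> = \<bar>W2 t * \<kappa> t\<bar>" using \<epsilon>[OF t] \<open>\<kappa> t0 > 0\<close> by (simp add: abs_mult)
    also have "\<dots> \<le> \<bar>W2 t * \<kappa> t + W1 t * m t\<bar> + \<bar>W1 t * m t\<bar>" by linarith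
    also have "\<dots> \<le> C * \<bar>w (\<sigma> t)\<bar> + \<bar>W1 t\<bar> * (\<bar>m t0\<bar> + 1)"
    proof (intro add_mono)
      show "\<bar>W2 t * \<kappa> t + W1 t * m t\<bar> \<le> C * \<bar>w (\<sigma> t)\<bar>"
        using bound[of "\<sigma> t"] \<epsilon>[OF t] eq[OF t] by simp
      show "\<bar>W1 t * m t\<bar> \<le> \<bar>W1 t\<bar> * (\<bar>m t0\<bar> + 1)"
        unfolding abs_mult using \<epsilon>[OF t] by (intro mult_left_mono) auto
    qed
    also have "\<dots> \<le> (\<bar>C\<bar> + (\<bar>m t0\<bar> + 1)) * \<bar>w (\<sigma> t)\<bar> + (\<bar>C\<bar> + (\<bar>m t0\<bar> + 1)) * \<bar>W1 t\<bar>"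
    proof (intro add_mono)
      show "C * \<bar>w (\<sigma> t)\<bar> \<le> (\<bar>C\<bar> + (\<bar>m t0\<bar> + 1)) * \<bar>w (\<sigma> t)\<bar>"
        by (intro mult_right_mono) auto
      show "\<bar>W1 t\<bar> * (\<bar>m t0\<bar> + 1) \<le> (\<bar>C\<bar> + (\<bar>m t0\<bar> + 1)) * \<bar>W1 t\<bar>"
        unfolding mult.commute[of "\<bar>W1 t\<bar>"] by (intro mult_right_mono) auto
    qed
    finally have "\<bar>W2 t\<bar> * (\<kappa> t0 / 2) \<le> (\<bar>C\<bar> + (\<bar>m t0\<bar> + 1)) * (\<bar>w (\<sigma> t)\<bar> + \<bar>W1 t\<bar>)"
      by (simp add: algebra_simps)
    then show ?thesis
      using \<open>\<kappa> t0 > 0\<close> by (simp add: K_def field_simps)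
  qed
  have dW: "((\<lambda>t. w (\<sigma> t)) has_real_derivative W1 t) (at t)"
    and dW1: "(W1 has_real_derivative W2 t) (at t)" if t: "t \<in> ball t0 \<epsilon>" for t
  proof -
    have in\<Omega>: "\<sigma> t \<in> \<Omega>" and inT: "t \<in> T" using \<epsilon>[OF t] by auto
    have s: "(\<sigma> has_derivative (\<lambda>h. h *\<^sub>R \<sigma>1 t)) (at t)"
      using \<sigma>[OF inT] by (simp add: has_vector_derivative_def)
    have s1: "(\<sigma>1 has_derivative (\<lambda>h. h *\<^sub>R \<sigma>2 t)) (at t)"
      using \<sigma>1[OF inT] by (simp add: has_vector_derivative_def)
    show "((\<lambda>t. w (\<sigma> t)) has_real_derivative W1 t) (at t)"
      using has_derivative_compose[OF s w[OF in\<Omega>]]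
      by (simp add: has_field_derivative_def W1_def mult.commute[of _ "_ \<bullet> _"])
    have "(W1 has_derivative (\<lambda>h. D (\<sigma> t) \<bullet> (h *\<^sub>R \<sigma>2 t) + (H (\<sigma> t) *v (h *\<^sub>R \<sigma>1 t)) \<bullet> \<sigma>1 t)) (at t)"
      unfolding W1_def by (rule has_derivative_inner[OF has_derivative_compose[OF s D[OF in\<Omega>]] s1])
    moreover have "(\<lambda>h. D (\<sigma> t) \<bullet> (h *\<^sub>R \<sigma>2 t) + (H (\<sigma> t) *v (h *\<^sub>R \<sigma>1 t)) \<bullet> \<sigma>1 t) = (*) (W2 t)"
      by (auto simp: W2_def fun_eq_iff algebra_simps matrix_vector_mult_scaleR)
    ultimately show "(W1 has_real_derivative W2 t) (at t)"
      by (simp add: has_field_derivative_def)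
  qed
  have ball: "ball t0 \<epsilon> = {t0 - \<epsilon><..<t0 + \<epsilon>}"
    by (auto simp: dist_real_def)
  have "w (\<sigma> t) = 0" if "s \<in> ball t0 \<epsilon>" "w (\<sigma> s) = 0" "D (\<sigma> s) \<bullet> \<sigma>1 s = 0" "t \<in> ball t0 \<epsilon>" for s t
    using second_order_gronwall[of "t0 - \<epsilon>" "t0 + \<epsilon>" "\<lambda>t. w (\<sigma> t)" W1 W2 K s t]
      dW dW1 W2_le that unfolding ball[symmetric] W1_def by blast
  then show ?thesis using \<open>\<epsilon> > 0\<close> by blast
qed

section \<open>Charts and differentials\<close>

text \<open>Directions on which a derivative within \<open>A\<close> is determined. Other directions are junk, since
  \<open>coord_space J\<close> may have empty interior; and only one-sided conditions are available, since a point
  of \<open>\<Sigma>\<close> may be an end point of the half-line.\<close>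

definition inward :: "'a::real_vector set \<Rightarrow> 'a \<Rightarrow> 'a \<Rightarrow> bool" where
  "inward A x v \<longleftrightarrow> (\<exists>\<delta>>0. \<forall>r. 0 \<le> r \<and> r \<le> \<delta> \<longrightarrow> x + r *\<^sub>R v \<in> A)"

lemma inward_mono: "inward A x v \<Longrightarrow> A \<subseteq> B \<Longrightarrow> inward B x v"
  unfolding inward_def by blast

lemma inward_base: "inward A x v \<Longrightarrow> x \<in> A"
  unfolding inward_def by (elim exE conjE) (drule spec[of _ 0], simp)

lemma inward_Int: "inward A x v \<Longrightarrow> inward B x v \<Longrightarrow> inward (A \<inter> B) x v"
  unfolding inward_def
  by (elim exE conjE, rule_tac x = "min \<delta> \<delta>'" in exI) auto

text \<open>The set \<open>C\<close> is a model space: a ray that stays in the model starts with a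
  short segment in any relatively open subset containing its origin.\<close>

lemma inward_openin:
  fixes x :: "'a::real_normed_vector"
  assumes "openin (top_of_set C) A" "x \<in> A" "\<And>r. 0 \<le> r \<Longrightarrow> x + r *\<^sub>R v \<in> C"
  shows "inward A x v"
proof -
  obtain O' where O': "open O'" "A = C \<inter> O'"
    using assms(1) by (auto simp: openin_open)
  have "isCont (\<lambda>r. x + r *\<^sub>R v) 0"
    by (intro continuous_intros)
  then have "((\<lambda>r. x + r *\<^sub>R v) \<longlongrightarrow> x) (nhds 0)"
    using tendsto_at_iff_tendsto_nhds[where g = "\<lambda>r. x + r *\<^sub>R v" and l = 0] by (simp add: isCont_def)
  then have "eventually (\<lambda>r. x + r *\<^sub>R v \<in> O') (nhds 0)"
    using O' assms(2) by (auto dest: topological_tendstoD)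
  then obtain d where "d > 0" "\<And>r. dist r 0 < d \<Longrightarrow> x + r *\<^sub>R v \<in> O'"
    unfolding eventually_nhds_metric by auto
  then show ?thesis
    unfolding inward_def using assms(3) O'(2) by (intro exI[of _ "d / 2"]) auto
qed

text \<open>Each candidate value at \<open>v\<close> is the one-sided derivative at 0 of r -> F(x +
  r v), and such a derivative on an interval [0, d] with d > 0 is unique.\<close>

lemma derivative_unique_inward:
  fixes F :: "'a::real_normed_vector \<Rightarrow> 'b::real_normed_vector"
  assumes F: "(F has_derivative F1) (at x within A)" "(F has_derivative F2) (at x within A)"
    and v: "inward A x v"
  shows "F1 v = F2 v"
proof -
  obtain d where d: "d > 0" "\<And>r. 0 \<le> r \<Longrightarrow> r \<le> d \<Longrightarrow> x + r *\<^sub>R v \<in> A"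
    using v unfolding inward_def by auto
  let ?l = "\<lambda>r. x + r *\<^sub>R v"
  have sub: "?l ` {0..d} \<subseteq> A" using d by auto
  have "((\<lambda>r. F (?l r)) has_vector_derivative F' v) (at 0 within {0..d})"
    if "(F has_derivative F') (at x within A)" for F'
  proof -
    have l: "(?l has_derivative (\<lambda>r. r *\<^sub>R v)) (at 0 within {0..d})"
      by (auto intro!: derivative_eq_intros)
    have "(F has_derivative F') (at (?l 0) within ?l ` {0..d})"
      using has_derivative_subset[OF that sub] by simp
    from diff_chain_within[OF l this] show ?thesis
      using has_derivative_linear[OF that]
      by (simp add: has_vector_derivative_def o_def linear_scale)
  qed
  then show ?thesis
    using F d(1) by (intro vector_derivative_unique_within[of 0 "{0..d}"])
      (auto simp: at_within_Icc_at_right trivial_limit_at_right_real)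
qed

text \<open>Near the point the coordinate expression agrees with the extension \<open>h\<close> on
  the chart image, so \<open>h'\<close> is one derivative within that image and
  \<open>coord_diff\<close> chooses another. This makes the chosen one linear, but it need agree
  with \<open>h'\<close> only in inward directions.\<close>

lemma coord_diff_eqI:
  assumes "snd c x \<in> W" "open W" "x \<in> fst c"
    and h: "(h has_derivative h') (at (snd c x))"
    and eq: "\<And>y. y \<in> snd c ` fst c \<Longrightarrow> y \<in> W \<Longrightarrow> h y = snd d (F (chart_inv c y))"
  shows "linear (coord_diff c d F x)"
    and "inward (snd c ` fst c) (snd c x) v \<Longrightarrow> coord_diff c d F x v = h' v"
proof -
  let ?A = "snd c ` fst c"
  obtain e where e: "e > 0" "ball (snd c x) e \<subseteq> W"
    using assms(1,2) open_contains_ball by blast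
  have *: "(snd d \<circ> F \<circ> chart_inv c has_derivative h') (at (snd c x) within ?A)"
  proof (rule has_derivative_transform_within[OF has_derivative_at_withinI[OF h] e(1)])
    show "snd c x \<in> ?A" using assms by auto
    fix y assume "y \<in> ?A" "dist y (snd c x) < e"
    then show "h y = (snd d \<circ> F \<circ> chart_inv c) y"
      using e(2) by (subst eq) (auto simp: dist_commute)
  qed
  then have **: "(snd d \<circ> F \<circ> chart_inv c has_derivative coord_diff c d F x) (at (snd c x) within ?A)"
    unfolding coord_diff_def using frechet_derivative_works differentiable_def by blast
  then show "linear (coord_diff c d F x)" by (rule has_derivative_linear)
  show "coord_diff c d F x v = h' v" if "inward ?A (snd c x) v"
    by (rule derivative_unique_inward[OF ** * that])
qed

lemma chart_properties:
  assumes X: "smooth_manifold X" and c: "c \<in> charts X"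
  shows "openin (mtop X) (fst c)" "inj_on (snd c) (fst c)"
    and "openin (top_of_set (model X)) (snd c ` fst c)"
    and "continuous_map (top_of_set (snd c ` fst c)) (mtop X) (chart_inv c)"
    and "openin (mtop X) V \<Longrightarrow> openin (top_of_set (model X)) (snd c ` (fst c \<inter> V))"
    and "openin (top_of_set (snd c ` fst c)) B \<Longrightarrow> openin (mtop X) {x \<in> fst c. snd c x \<in> B}"
proof -
  show 1: "openin (mtop X) (fst c)" and 2: "openin (top_of_set (model X)) (snd c ` fst c)"
    using assms unfolding smooth_manifold_def by blast+
  have hom: "homeomorphic_map (subtopology (mtop X) (fst c)) (top_of_set (snd c ` fst c)) (snd c)"
    using assms unfolding smooth_manifold_def by blast
  have ts: "topspace (subtopology (mtop X) (fst c)) = fst c"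
    using openin_subset[OF 1] by auto
  show inj: "inj_on (snd c) (fst c)"
    using hom ts by (metis homeomorphic_imp_injective_map)
  from hom obtain k where k: "homeomorphic_maps (subtopology (mtop X) (fst c)) (top_of_set (snd c ` fst c)) (snd c) k"
    unfolding homeomorphic_map_maps by blast
  have "continuous_map (top_of_set (snd c ` fst c)) (mtop X) k"
    using k by (simp add: homeomorphic_maps_def continuous_map_in_subtopology)
  then show "continuous_map (top_of_set (snd c ` fst c)) (mtop X) (chart_inv c)"
  proof (rule continuous_map_eq)
    fix y assume "y \<in> topspace (top_of_set (snd c ` fst c))"
    then obtain x where "x \<in> fst c" "y = snd c x" by auto
    then show "k y = chart_inv c y"
      using k inj ts by (auto simp: homeomorphic_maps_def)
  qed
  show "openin (top_of_set (model X)) (snd c ` (fst c \<inter> V))" if "openin (mtop X) V"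
  proof -
    have "openin (subtopology (mtop X) (fst c)) (fst c \<inter> V)"
      using that by (simp add: openin_subtopology_Int2)
    then have "openin (top_of_set (snd c ` fst c)) (snd c ` (fst c \<inter> V))"
      using homeomorphic_imp_open_map[OF hom] by (simp add: open_map_def)
    then show ?thesis using 2 by (rule openin_trans)
  qed
  show "openin (mtop X) {x \<in> fst c. snd c x \<in> B}" if "openin (top_of_set (snd c ` fst c)) B"
  proof -
    have "openin (subtopology (mtop X) (fst c)) {x \<in> topspace (subtopology (mtop X) (fst c)). snd c x \<in> B}"
      using homeomorphic_imp_continuous_map[OF hom] that by (rule openin_continuous_map_preimage)
    then show ?thesis unfolding ts using 1 by (rule openin_trans_full)
  qed
qed

text \<open>A point outside \<open>boundary X\<close> has nonzero first coordinate in every chart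
  around it. The image therefore lies in the open half-space, where relatively open sets are
  open.\<close>

lemma interior_chart_open:
  fixes X :: "('x, 'e::euclidean_space) mfd"
  assumes X: "smooth_manifold X" "model X = half_space" and c: "c \<in> charts X"
    and V: "openin (mtop X) V" "V \<inter> boundary X = {}"
  shows "open (snd c ` (fst c \<inter> V))"
proof -
  let ?b = "SOME b :: 'e. b \<in> Basis"
  have "openin (top_of_set half_space) (snd c ` (fst c \<inter> V))"
    using chart_properties(5)[OF X(1) c V(1)] X(2) by simp
  then obtain O' where O': "open O'" "snd c ` (fst c \<inter> V) = half_space \<inter> O'"
    by (auto simp: openin_open)
  have "snd c x \<bullet> ?b \<noteq> 0" if "x \<in> fst c \<inter> V" for x
    using that V(2) c unfolding boundary_def charts_at_def by blast
  then have "snd c ` (fst c \<inter> V) \<subseteq> {y. y \<bullet> ?b \<noteq> 0}" by blast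
  then have "snd c ` (fst c \<inter> V) = {y. 0 < y \<bullet> ?b} \<inter> O'"
    unfolding O'(2) half_space_def by force
  moreover have "open {y. 0 < y \<bullet> ?b}"
    by (intro open_Collect_less continuous_intros)
  ultimately show ?thesis using O'(1) by auto
qed

text \<open>\<open>C_on\<close> provides an extension that matches the map only at points sent into
  the chart \<open>d\<close>. Continuity makes the set of these points relatively open, and
  shrinking \<open>W\<close> accordingly guarantees that nearby points do land in
  \<open>d\<close>.\<close>

lemma smooth_extension:
  assumes X: "smooth_manifold X" and Y: "smooth_manifold Y"
    and F: "C_map \<infinity> X Y F" and c: "c \<in> charts_at X x" and d: "d \<in> charts_at Y (F x)"
  obtains W h where "open W" "snd c x \<in> W" "\<And>k. C_open k h W"
    "\<And>x'. x' \<in> fst c \<Longrightarrow> snd c x' \<in> W \<Longrightarrow> F x' \<in> fst d \<and> h (snd c x') = snd d (F x')"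
proof -
  let ?D = "{x \<in> fst c. F x \<in> fst d}"
  have cX: "c \<in> charts X" "x \<in> fst c" and dY: "d \<in> charts Y" "F x \<in> fst d"
    using c d by (auto simp: charts_at_def)
  have inj: "inj_on (snd c) (fst c)" by (rule chart_properties(2)[OF X cX(1)])
  have "C_on \<infinity> (snd c ` ?D) (snd d \<circ> F \<circ> chart_inv c)"
    using F cX dY by (simp add: C_map_def)
  moreover have "snd c x \<in> snd c ` ?D" using cX dY by auto
  ultimately have "\<exists>W h. open W \<and> snd c x \<in> W \<and> (\<forall>k. C_open k h W) \<and>
      (\<forall>y\<in>snd c ` ?D \<inter> W. h y = (snd d \<circ> F \<circ> chart_inv c) y)"
    by (simp only: C_on_def enat_ord_simps simp_thms)
  then obtain W h where W: "open W" "snd c x \<in> W" "\<And>k. C_open k h W"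
    and h: "\<And>y. y \<in> snd c ` ?D \<Longrightarrow> y \<in> W \<Longrightarrow> h y = (snd d \<circ> F \<circ> chart_inv c) y"
    by blast
  have "openin (mtop X) {x \<in> points X. F x \<in> fst d}"
    using F chart_properties(1)[OF Y dY(1)] openin_continuous_map_preimage
    unfolding C_map_def by blast
  then have "openin (top_of_set (model X)) (snd c ` (fst c \<inter> {x \<in> points X. F x \<in> fst d}))"
    by (rule chart_properties(5)[OF X cX(1)])
  moreover have "fst c \<inter> {x \<in> points X. F x \<in> fst d} = ?D"
    using openin_subset[OF chart_properties(1)[OF X cX(1)]] by auto
  ultimately obtain O' where O': "open O'" "snd c ` ?D = model X \<inter> O'"
    by (auto simp: openin_open)
  have "snd c ` fst c \<subseteq> model X"
    using openin_subset[OF chart_properties(3)[OF X cX(1)]] by simp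
  then have D: "x' \<in> ?D" if "x' \<in> fst c" "snd c x' \<in> O'" for x'
  proof -
    have "snd c x' \<in> snd c ` ?D" unfolding O'(2) using that \<open>snd c ` fst c \<subseteq> model X\<close> by blast
    then show ?thesis using inj that(1) by (auto dest: inj_onD)
  qed
  have "h (snd c x') = snd d (F x')" if "x' \<in> ?D" "snd c x' \<in> W" for x'
    using h[of "snd c x'"] that inj by auto
  then have "F x' \<in> fst d \<and> h (snd c x') = snd d (F x')" if "x' \<in> fst c" "snd c x' \<in> W \<inter> O'" for x'
    using D[of x'] that by blast
  moreover have "C_open k h (W \<inter> O')" for k
    by (rule C_open_transform[OF W(3)]) (use W O' in auto)
  moreover have "open (W \<inter> O')" "snd c x \<in> W \<inter> O'"
    using W(1,2) O' \<open>snd c x \<in> snd c ` ?D\<close> by auto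
  ultimately show ?thesis
    using that[of "W \<inter> O'" h] by blast
qed

lemma half_line: "(half_space :: real set) = {0..}"
proof -
  have "(SOME b. b \<in> (Basis :: real set)) = 1" by simp
  then show ?thesis unfolding half_space_def by auto
qed

lemma subspace_coord_space: "subspace (coord_space J)"
  by (auto simp: subspace_def coord_space_def)

section \<open>The Laplace-Beltrami operator in coordinates\<close>

definition grad :: "(real^'n::finite \<Rightarrow> real) \<Rightarrow> real^'n \<Rightarrow> real^'n" where
  "grad f y = (\<chi> j. partial j f y)"

text \<open>Row \<open>j\<close> is the gradient of \<open>partial j f\<close>, so that
  multiplication by this matrix is the derivative of \<open>grad f\<close>.\<close>

definition hess :: "(real^'n::finite \<Rightarrow> real) \<Rightarrow> real^'n \<Rightarrow> real^'n^'n" where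
  "hess f y = (\<chi> j i. partial i (partial j f) y)"

lemma frechet_derivative_grad:
  assumes "f differentiable (at y)"
  shows "frechet_derivative f (at y) v = grad f y \<bullet> v"
proof -
  have lin: "linear (frechet_derivative f (at y))"
    using assms by (rule linear_frechet_derivative)
  have "frechet_derivative f (at y) v = frechet_derivative f (at y) (\<Sum>i\<in>UNIV. v $ i *s axis i 1)"
    by (simp add: basis_expansion)
  also have "\<dots> = (\<Sum>i\<in>UNIV. v $ i * partial i f y)"
    by (simp add: linear_sum[OF lin] linear_scale[OF lin] scalar_mult_eq_scaleR partial_def)
  also have "\<dots> = grad f y \<bullet> v"
    by (simp add: grad_def inner_vec_def mult.commute)
  finally show ?thesis .
qed

lemma has_derivative_grad:
  assumes "f differentiable (at y)"
  shows "(f has_derivative (\<lambda>v. grad f y \<bullet> v)) (at y)"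
  using assms by (simp add: frechet_derivative_works flip: frechet_derivative_grad[OF assms])

lemma partial_eqI:
  assumes "(f has_derivative f') (at y)"
  shows "partial i f y = f' (axis i 1)"
  using frechet_derivative_at[OF assms] by (simp add: partial_def)

lemma C_open_partial:
  assumes "C_open (Suc k) f U"
  shows "C_open k (partial j f) U"
  using assms unfolding partial_def[abs_def] by simp

text \<open>\<open>C_open\<close> speaks of the maps y -> Df(y) v for one fixed \<open>v\<close> at
  a time. The derivative of \<open>grad f\<close> is assembled from these componentwise, and
  continuity of the second derivatives gives symmetry through
  \<open>second_derivative_symmetric\<close>.\<close>

lemma C_open_2_second_order:
  assumes "open U" "C_open (Suc (Suc 0)) f U" "y \<in> U"
  shows "(f has_derivative (\<lambda>v. grad f y \<bullet> v)) (at y)"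
    and "(grad f has_derivative (\<lambda>z. hess f y *v z)) (at y)"
    and "transpose (hess f y) = hess f y"
proof -
  have f: "f differentiable (at z)" if "z \<in> U" for z
    using assms(2) that by simp
  show "(f has_derivative (\<lambda>v. grad f y \<bullet> v)) (at y)"
    by (rule has_derivative_grad[OF f[OF assms(3)]])
  have pd: "C_open (Suc 0) (partial j f) U" for j
    by (rule C_open_partial[OF assms(2)])
  then have p: "partial j f differentiable (at z)" if "z \<in> U" for j z
    using that by simp
  show "(grad f has_derivative (\<lambda>z. hess f y *v z)) (at y)"
  proof (subst has_derivative_componentwise_within, rule ballI)
    fix e :: "real^'a" assume "e \<in> Basis"
    then obtain j where e: "e = axis j 1"
      by (auto simp: Basis_vec_def)
    have "(hess f y *v z) \<bullet> e = grad (partial j f) y \<bullet> z" for z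
    proof -
      have "(hess f y *v z) \<bullet> e = (hess f y *v z) $ j" by (simp add: e inner_axis)
      then show ?thesis by (simp add: hess_def grad_def matrix_vector_mult_def inner_vec_def)
    qed
    moreover have "grad f z \<bullet> e = partial j f z" for z
      by (simp add: e inner_axis grad_def)
    ultimately show "((\<lambda>x. grad f x \<bullet> e) has_derivative (\<lambda>z. (hess f y *v z) \<bullet> e)) (at y)"
      using has_derivative_grad[OF p[OF assms(3)]] by simp
  qed
  have "partial i (partial j f) y = partial j (partial i f) y" for i j
  proof -
    let ?d = "\<lambda>z. frechet_derivative f (at z)"
    let ?dd = "\<lambda>j z. frechet_derivative (partial j f) (at z)"
    have 1: "(f has_derivative ?d z) (at z)" if "z \<in> U" for z
      using f[OF that] by (simp add: frechet_derivative_works)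
    have 2: "((\<lambda>z. ?d z (axis j 1)) has_derivative ?dd j z) (at z)" if "z \<in> U" for z j
      using p[OF that, of j] by (simp add: frechet_derivative_works partial_def[abs_def])
    have 3: "isCont (\<lambda>z. ?dd j z v) y" for j v
      using pd[of j] assms(1,3) by (auto simp: continuous_on_eq_continuous_at)
    show ?thesis
      using second_derivative_symmetric[OF assms(1,3) 1 2 2 3 3, of j i] by (simp add: partial_def[abs_def])
  qed
  then show "transpose (hess f y) = hess f y"
    by (simp add: transpose_def hess_def vec_eq_iff)
qed

text \<open>The first-order coefficients of the Laplace-Beltrami operator of the metric matrix
  \<open>q\<close>, as they appear when its divergence form is expanded by the product rule.\<close>

definition drift :: "(real^'n::finite \<Rightarrow> real^'n^'n) \<Rightarrow> real^'n \<Rightarrow> real^'n" where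
  "drift q y = (\<chi> j. (\<Sum>i\<in>UNIV. partial i (\<lambda>y. sqrt (det (q y)) * matrix_inv (q y) $ i $ j) y)
     / sqrt (det (q y)))"

lemma C_open_1_density_inverse:
  fixes q :: "real^'n::finite \<Rightarrow> real^'n^'n"
  assumes "open U" "\<And>i j. C_open (Suc 0) (\<lambda>x. q x $ i $ j) U" "\<And>x. x \<in> U \<Longrightarrow> det (q x) \<noteq> 0"
  shows "C_open (Suc 0) (\<lambda>y. sqrt (det (q y)) * matrix_inv (q y) $ i $ j) U"
  by (intro C_open_1_mult C_open_1_sqrt C_open_1_det C_open_1_matrix_inv assms)

lemma isCont_drift:
  fixes q :: "real^'n::finite \<Rightarrow> real^'n^'n"
  assumes U: "open U" and q: "\<And>i j. C_open (Suc 0) (\<lambda>x. q x $ i $ j) U"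
    and nz: "\<And>x. x \<in> U \<Longrightarrow> det (q x) \<noteq> 0" and y: "y \<in> U"
  shows "isCont (drift q) y"
proof -
  have at: "isCont h y" if "continuous_on U h" for h :: "real^'n \<Rightarrow> real"
    using that U y by (simp add: continuous_on_eq_continuous_at)
  have "C_open 0 (partial i (\<lambda>y. sqrt (det (q y)) * matrix_inv (q y) $ i $ j)) U" for i j
    by (rule C_open_partial[OF C_open_1_density_inverse[OF U q nz]])
  then have 1: "isCont (partial i (\<lambda>y. sqrt (det (q y)) * matrix_inv (q y) $ i $ j)) y" for i j
    using at by simp
  have 2: "isCont (\<lambda>y. sqrt (det (q y))) y"
    by (intro at C_open_Suc_0_continuous C_open_1_sqrt C_open_1_det q nz)
  have "isCont (\<lambda>y. (\<Sum>i\<in>UNIV. partial i (\<lambda>y. sqrt (det (q y)) * matrix_inv (q y) $ i $ j) y)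
     / sqrt (det (q y))) y" for j
    using nz[OF y] by (intro continuous_divide continuous_sum 1 2) auto
  then show ?thesis
    unfolding drift_def[abs_def] isCont_def by (intro tendsto_vec_lambda)
qed

lemma laplace_beltrami_expansion:
  fixes g :: "('x, 'n::finite) metric" and u :: "'x \<Rightarrow> real"
  defines "q \<equiv> \<lambda>c y. g c (chart_inv c y)"
  assumes U: "open U" and q: "\<And>i j. C_open (Suc 0) (\<lambda>y. q c y $ i $ j) U"
    and nz: "\<And>y. y \<in> U \<Longrightarrow> det (q c y) \<noteq> 0"
    and v: "C_open (Suc (Suc 0)) (u \<circ> chart_inv c) U" and x: "snd c x = y" "y \<in> U"
  shows "laplace_beltrami g c u x
    = (\<Sum>i\<in>UNIV. \<Sum>j\<in>UNIV. matrix_inv (q c y) $ i $ j * hess (u \<circ> chart_inv c) y $ i $ j)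
      + drift (q c) y \<bullet> grad (u \<circ> chart_inv c) y"
proof -
  define v where "v = u \<circ> chart_inv c"
  define w where "w y = sqrt (det (q c y))" for y
  define P where "P i j y = w y * matrix_inv (q c y) $ i $ j" for i j y
  have w: "w y \<noteq> 0" using nz[OF x(2)] by (simp add: w_def)
  have P: "(P i j has_derivative frechet_derivative (P i j) (at y)) (at y)" for i j
    unfolding P_def w_def
    by (rule C_open_Suc_0D[OF C_open_1_density_inverse[OF U q nz] x(2)])
  have dv: "(partial j v has_derivative frechet_derivative (partial j v) (at y)) (at y)" for j
    unfolding v_def by (rule C_open_Suc_0D[OF C_open_partial[OF assms(5)] x(2)])
  have 1: "partial i (\<lambda>y. w y * (\<Sum>j\<in>UNIV. matrix_inv (q c y) $ i $ j * partial j v y)) y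
      = (\<Sum>j\<in>UNIV. P i j y * partial i (partial j v) y + partial i (P i j) y * partial j v y)" for i
  proof -
    have "((\<lambda>y. \<Sum>j\<in>UNIV. P i j y * partial j v y) has_derivative
      (\<lambda>h. \<Sum>j\<in>UNIV. P i j y * frechet_derivative (partial j v) (at y) h
         + frechet_derivative (P i j) (at y) h * partial j v y)) (at y)"
      by (intro has_derivative_sum has_derivative_mult P dv)
    moreover have "(\<lambda>y. w y * (\<Sum>j\<in>UNIV. matrix_inv (q c y) $ i $ j * partial j v y))
        = (\<lambda>y. \<Sum>j\<in>UNIV. P i j y * partial j v y)"
      by (simp add: P_def sum_distrib_left mult.assoc)
    ultimately show ?thesis
      by (simp add: partial_eqI) (simp add: partial_def)
  qed
  \<comment> \<open>The product rule produces the two partial derivatives in the order opposite to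
    that in \<open>hess\<close>.\<close>
  have sym: "hess v y $ i $ j = partial i (partial j v) y" for i j
    using C_open_2_second_order(3)[OF U assms(5) x(2)]
    by (metis (no_types, lifting) hess_def transpose_def v_def vec_lambda_beta)
  have "laplace_beltrami g c u x
      = (\<Sum>i\<in>UNIV. partial i (\<lambda>y. w y * (\<Sum>j\<in>UNIV. matrix_inv (q c y) $ i $ j * partial j v y)) y) / w y"
    unfolding laplace_beltrami_def Let_def x(1) w_def v_def q_def ..
  also have "\<dots> = (\<Sum>i\<in>UNIV. \<Sum>j\<in>UNIV. matrix_inv (q c y) $ i $ j * hess v y $ i $ j)
      + (\<Sum>i\<in>UNIV. \<Sum>j\<in>UNIV. partial i (P i j) y / w y * partial j v y)"
    using w by (simp add: 1 sym sum.distrib sum_divide_distrib add_divide_distrib P_def)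
  also have "(\<Sum>i\<in>UNIV. \<Sum>j\<in>UNIV. partial i (P i j) y / w y * partial j v y) = drift (q c) y \<bullet> grad v y"
    by (subst sum.swap)
       (simp add: drift_def grad_def inner_vec_def P_def[abs_def] w_def sum_divide_distrib sum_distrib_right)
  finally show ?thesis unfolding v_def .
qed

text \<open>Around a point interior to \<open>A\<close> the local extension coincides with
  \<open>f\<close>, so \<open>f\<close> itself is differentiable there to the required
  order.\<close>

lemma C_on_open:
  assumes "C_on r A f" "x \<in> A" "open U" "x \<in> U" "U \<subseteq> A"
  obtains W where "open W" "x \<in> W" "W \<subseteq> U" "\<And>k. enat k \<le> r \<Longrightarrow> C_open k f W"
proof -
  obtain W h where W: "open W" "x \<in> W" "\<forall>k. enat k \<le> r \<longrightarrow> C_open k h W" "\<forall>y\<in>A \<inter> W. h y = f y"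
    using assms(1,2) unfolding C_on_def by blast
  have "C_open k f (W \<inter> U)" if "enat k \<le> r" for k
    by (rule C_open_transform[of k h W]) (use W assms that in auto)
  then show ?thesis
    using that[of "W \<inter> U"] W assms by auto
qed

section \<open>Polar actions\<close>

context polar_setting
begin

interpretation action: group_action G "points M" \<phi>
  using action by (simp add: isometric_action_def)

lemma group_one: "\<one>\<^bsub>G\<^esub> \<in> carrier G"
  using lie_group group.is_monoid monoid.one_closed unfolding lie_group_def by blast

lemma action_one: "x \<in> points M \<Longrightarrow> \<phi> \<one>\<^bsub>G\<^esub> x = x"
  using action.id_eq_one by (metis restrict_apply')

lemma section_in_regular_part: "regular_section G M \<phi> S \<subseteq> regular_part G M \<phi>"
  using section_manifold(2) by (auto simp: regular_points_def immersed_submanifold_def)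

text \<open>The smooth action map read in a product chart at (1, x). Since the unit fixes
  \<open>x\<close>, the same chart \<open>c\<close> serves for source and target.\<close>

lemma action_extension:
  assumes x: "x \<in> points M" and b: "b \<in> charts_at L \<one>\<^bsub>G\<^esub>" and c: "c \<in> charts_at M x"
  obtains W h where "open W" "(snd b \<one>\<^bsub>G\<^esub>, snd c x) \<in> W" "\<And>k. C_open k h W"
    "\<And>a z. a \<in> fst b \<Longrightarrow> z \<in> fst c \<Longrightarrow> \<phi> a z \<in> fst c \<Longrightarrow> (snd b a, snd c z) \<in> W \<Longrightarrow>
      h (snd b a, snd c z) = snd c (\<phi> a z)"
proof -
  have cM: "c \<in> charts M" "x \<in> fst c" and bL: "b \<in> charts L" "\<one>\<^bsub>G\<^esub> \<in> fst b"
    using b c by (auto simp: charts_at_def)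
  have L: "smooth_manifold L" using lie_group by (simp add: lie_group_def)
  have injb: "inj_on (snd b) (fst b)" by (rule chart_properties(2)[OF L bL(1)])
  have injc: "inj_on (snd c) (fst c)" by (rule chart_properties(2)[OF manifold(1) cM(1)])
  let ?p = "(fst b \<times> fst c, map_prod (snd b) (snd c))"
  let ?F = "\<lambda>(a, x). \<phi> a x"
  let ?D = "{z \<in> fst ?p. ?F z \<in> fst c}"
  have "?p \<in> charts (prod_mfd L M)"
    unfolding prod_mfd_def mfd.select_convs mem_Collect_eq using cM(1) bL(1)
    by (intro exI[of _ b] exI[of _ c] conjI refl)
  then have "C_on \<infinity> (snd ?p ` ?D) (snd c \<circ> ?F \<circ> chart_inv ?p)"
    using action cM unfolding isometric_action_def C_map_def by blast
  moreover have "(snd b \<one>\<^bsub>G\<^esub>, snd c x) \<in> snd ?p ` ?D"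
    using cM bL action_one[OF x] by (auto intro!: image_eqI[of _ _ "(\<one>\<^bsub>G\<^esub>, x)"])
  ultimately have "\<exists>W h. open W \<and> (snd b \<one>\<^bsub>G\<^esub>, snd c x) \<in> W \<and> (\<forall>k. C_open k h W) \<and>
      (\<forall>y\<in>snd ?p ` ?D \<inter> W. h y = (snd c \<circ> ?F \<circ> chart_inv ?p) y)"
    by (simp only: C_on_def enat_ord_simps simp_thms)
  then obtain W h where W: "open W" "(snd b \<one>\<^bsub>G\<^esub>, snd c x) \<in> W" "\<And>k. C_open k h W"
    and h: "\<And>y. y \<in> snd ?p ` ?D \<Longrightarrow> y \<in> W \<Longrightarrow> h y = (snd c \<circ> ?F \<circ> chart_inv ?p) y"
    by blast
  have inv: "chart_inv ?p (snd b a, snd c z) = (a, z)" if "a \<in> fst b" "z \<in> fst c" for a z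
  proof -
    have "inj_on (map_prod (snd b) (snd c)) (fst b \<times> fst c)"
      by (rule map_prod_inj_on[OF injb injc])
    from inv_into_f_f[OF this, of "(a, z)"] that show ?thesis by simp
  qed
  show ?thesis
  proof (rule that[OF W])
    fix a z
    assume *: "a \<in> fst b" "z \<in> fst c" "\<phi> a z \<in> fst c" "(snd b a, snd c z) \<in> W"
    then have "(snd b a, snd c z) \<in> snd ?p ` ?D"
      by (auto intro!: image_eqI[of _ _ "(a, z)"])
    from h[OF this *(4)] show "h (snd b a, snd c z) = snd c (\<phi> a z)"
      using inv[OF *(1,2)] by simp
  qed
qed

lemma orbit_map_domain_open:
  assumes x: "x \<in> points M" and b: "b \<in> charts L" and c: "c \<in> charts M"
  shows "openin (top_of_set (model L)) (snd b ` {a \<in> fst b. \<phi> a x \<in> fst c})"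
proof -
  have L: "smooth_manifold L" using lie_group by (simp add: lie_group_def)
  have "continuous_map (mtop L) (prod_topology (mtop L) (mtop M)) (\<lambda>a. (a, x))"
    using x by (intro continuous_map_pairedI) auto
  moreover have "continuous_map (prod_topology (mtop L) (mtop M)) (mtop M) (\<lambda>(a, x). \<phi> a x)"
    using action by (simp add: isometric_action_def C_map_def prod_mfd_def)
  ultimately have "continuous_map (mtop L) (mtop M) ((\<lambda>(a, x). \<phi> a x) \<circ> (\<lambda>a. (a, x)))"
    by (rule continuous_map_compose)
  then have "continuous_map (mtop L) (mtop M) (\<lambda>a. \<phi> a x)"
    by (simp add: o_def)
  then have "openin (mtop L) {a \<in> points L. \<phi> a x \<in> fst c}"
    using openin_continuous_map_preimage chart_properties(1)[OF manifold(1) c] by blast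
  then have "openin (top_of_set (model L)) (snd b ` (fst b \<inter> {a \<in> points L. \<phi> a x \<in> fst c}))"
    by (rule chart_properties(5)[OF L b])
  moreover have "fst b \<subseteq> points L"
    using openin_subset[OF chart_properties(1)[OF L b]] .
  then have "fst b \<inter> {a \<in> points L. \<phi> a x \<in> fst c} = {a \<in> fst b. \<phi> a x \<in> fst c}"
    by auto
  ultimately show ?thesis by simp
qed

text \<open>The model of the group is a coordinate subspace, so moving from the unit along a vector
  of its span never leaves the model, and for short times stays in the relatively open set of group
  elements keeping \<open>x\<close> in the chart \<open>c\<close>.\<close>

lemma orbit_direction_inward:
  assumes x: "x \<in> points M" and b: "b \<in> charts_at L \<one>\<^bsub>G\<^esub>" and c: "c \<in> charts_at M x"
    and v: "v \<in> span (model L)"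
  shows "inward (snd b ` {a \<in> fst b. \<phi> a x \<in> fst c}) (snd b \<one>\<^bsub>G\<^esub>) v"
proof -
  have cM: "c \<in> charts M" "x \<in> fst c" and bL: "b \<in> charts L" "\<one>\<^bsub>G\<^esub> \<in> fst b"
    using b c by (auto simp: charts_at_def)
  obtain J where J: "model L = coord_space J" using lie_group by (auto simp: lie_group_def)
  note op = orbit_map_domain_open[OF x bL(1) cM(1)]
  have one: "snd b \<one>\<^bsub>G\<^esub> \<in> snd b ` {a \<in> fst b. \<phi> a x \<in> fst c}"
    using bL cM action_one[OF x] by auto
  then have "snd b \<one>\<^bsub>G\<^esub> \<in> coord_space J"
    using openin_subset[OF op] J by auto
  then have "snd b \<one>\<^bsub>G\<^esub> + r *\<^sub>R v \<in> model L" for r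
    using v subspace_coord_space[of J] unfolding J
    by (simp add: span_eq_iff[THEN iffD2] subspace_add subspace_scale)
  then show ?thesis
    by (rule inward_openin[OF op one])
qed

text \<open>The curve \<tau> extends the coordinate expression of the section to a full
  neighbourhood of the parameter, also past an end point of the half-line. The direction 1 is inward
  at every point of the half-line, so the differential of the inclusion at 1 is the velocity of
  \<tau>.\<close>

lemma section_extension:
  assumes p: "p \<in> points S" and c: "c \<in> charts_at M p" and s: "s \<in> charts_at S p"
  obtains T \<tau> where "open T" "snd s p \<in> T" "\<And>k. C_open k \<tau> T"
    "\<And>x. x \<in> fst s \<Longrightarrow> snd s x \<in> T \<Longrightarrow> x \<in> fst c \<and> \<tau> (snd s x) = snd c x"
    "linear (coord_diff s c (\<lambda>x. x) p)"
    "coord_diff s c (\<lambda>x. x) p 1 = frechet_derivative \<tau> (at (snd s p)) 1"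
proof -
  have S: "smooth_manifold S" "C_map \<infinity> S M (\<lambda>x. x)"
    using section_manifold(2) by (auto simp: immersed_submanifold_def)
  have sS: "s \<in> charts S" "p \<in> fst s" using s by (auto simp: charts_at_def)
  have inj: "inj_on (snd s) (fst s)" by (rule chart_properties(2)[OF S(1) sS(1)])
  obtain T \<tau> where T: "open T" "snd s p \<in> T" "\<And>k. C_open k \<tau> T"
    and \<tau>: "\<And>x. x \<in> fst s \<Longrightarrow> snd s x \<in> T \<Longrightarrow> x \<in> fst c \<and> \<tau> (snd s x) = snd c x"
    using smooth_extension[OF S(1) manifold(1) S(2) s c] by metis
  have d: "(\<tau> has_derivative frechet_derivative \<tau> (at (snd s p))) (at (snd s p))"
    using T(3)[of "Suc 0"] T(2) by (simp add: frechet_derivative_works)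
  have eq: "\<tau> y = snd c (chart_inv s y)" if y: "y \<in> snd s ` fst s" "y \<in> T" for y
  proof -
    obtain x where "x \<in> fst s" "y = snd s x" using y(1) by auto
    then show ?thesis using \<tau>[of x] y(2) inj by simp
  qed
  note cd = coord_diff_eqI[where F = "\<lambda>x. x" and d = c, OF T(2,1) sS(2) d eq]
  have o: "openin (top_of_set half_space) (snd s ` fst s)"
    using chart_properties(3)[OF S(1) sS(1)] section_manifold(1) by simp
  have "inward (snd s ` fst s) (snd s p) 1"
  proof (rule inward_openin[OF o])
    show "snd s p \<in> snd s ` fst s" using sS by auto
    then have "snd s p \<in> half_space" using openin_subset[OF o] by auto
    then show "snd s p + r *\<^sub>R 1 \<in> half_space" if "0 \<le> r" for r
      using that by (simp add: half_line)
  qed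
  with cd have "linear (coord_diff s c (\<lambda>x. x) p)"
    "coord_diff s c (\<lambda>x. x) p 1 = frechet_derivative \<tau> (at (snd s p)) 1" by blast+
  with that[OF T \<tau>] show ?thesis by blast
qed

text \<open>The fields \<open>X k\<close> are fundamental vector fields of the action, read in the chart \<open>c\<close>.\<close>

lemma radial_frame:
  assumes p: "p \<in> regular_section G M \<phi> S" and c: "c \<in> charts_at M p" and s: "s \<in> charts_at S p"
  obtains \<Omega> X DX and a :: "real^'n"
  where "open \<Omega>" "snd c p \<in> \<Omega>" "\<Omega> \<subseteq> snd c ` (fst c \<inter> regular_part G M \<phi>)"
    "\<And>k y. y \<in> \<Omega> \<Longrightarrow> (X k has_derivative DX k y) (at y)"
    "\<And>k v. isCont (\<lambda>y. DX k y v) (snd c p)"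
    "\<And>u d k y. \<lbrakk>\<And>a x. a \<in> carrier G \<Longrightarrow> x \<in> regular_part G M \<phi> \<Longrightarrow> u (\<phi> a x) = u x; y \<in> \<Omega>;
       (u \<circ> chart_inv c has_derivative d) (at y)\<rbrakk> \<Longrightarrow> d (X k y) = (0::real)"
    "\<And>k. axis k 1 = a $ k *\<^sub>R coord_diff s c (\<lambda>x. x) p 1 + X k (snd c p)" "a \<noteq> 0"
proof -
  let ?R = "regular_part G M \<phi>"
  have pR: "p \<in> ?R" using p section_in_regular_part by auto
  then have pM: "p \<in> points M" and pb: "p \<notin> boundary M" by (auto simp: regular_points_def)
  have pS: "p \<in> points S" "orbit G \<phi> p \<noteq> {p}" using p by (auto simp: regular_points_def)
  have cM: "c \<in> charts M" "p \<in> fst c" using c by (auto simp: charts_at_def)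
  have injc: "inj_on (snd c) (fst c)" by (rule chart_properties(2)[OF manifold(1) cM(1)])
  have L: "smooth_manifold L" using lie_group by (simp add: lie_group_def)
  obtain b where b: "b \<in> charts_at L \<one>\<^bsub>G\<^esub>"
    using lie_group group_one unfolding lie_group_def smooth_manifold_def charts_at_def by blast
  then have bL: "b \<in> charts L" "\<one>\<^bsub>G\<^esub> \<in> fst b" by (auto simp: charts_at_def)
  have injb: "inj_on (snd b) (fst b)" by (rule chart_properties(2)[OF L bL(1)])
  have bG: "fst b \<subseteq> carrier G"
    using openin_subset[OF chart_properties(1)[OF L bL(1)]] lie_group by (simp add: lie_group_def)
  obtain W h where W: "open W" "(snd b \<one>\<^bsub>G\<^esub>, snd c p) \<in> W" "\<And>k. C_open k h W"
    and h: "\<And>a z. a \<in> fst b \<Longrightarrow> z \<in> fst c \<Longrightarrow> \<phi> a z \<in> fst c \<Longrightarrow> (snd b a, snd c z) \<in> W \<Longrightarrow>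
      h (snd b a, snd c z) = snd c (\<phi> a z)"
    using action_extension[OF pM b c] by metis
  let ?e = "snd b \<one>\<^bsub>G\<^esub>"
  define \<Omega> where "\<Omega> = snd c ` (fst c \<inter> ?R) \<inter> {y. (?e, y) \<in> W}"
  have "?R \<inter> boundary M = {}" by (auto simp: regular_points_def)
  then have "open (snd c ` (fst c \<inter> ?R))"
    by (rule interior_chart_open[OF manifold(1,2) cM(1) regular_open])
  moreover have "open {y. (?e, y) \<in> W}"
    using open_vimage[OF W(1), of "Pair ?e"] by (simp add: vimage_def continuous_on_Pair)
  ultimately have \<Omega>: "open \<Omega>" by (simp add: \<Omega>_def open_Int)
  have p\<Omega>: "snd c p \<in> \<Omega>" using cM pR W(2) by (auto simp: \<Omega>_def)
  \<comment> \<open>\<open>E v\<close> is the fundamental field generated by the tangent vector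
    \<open>v\<close> at the unit, namely the derivative of the extended action in the group
    variable; \<open>DE v\<close> is its derivative in the space variable.\<close>
  define E where "E v y = frechet_derivative h (at (?e, y)) (v, 0)" for v :: "real^'k" and y
  define DE where "DE v y z = frechet_derivative (\<lambda>z. frechet_derivative h (at z) (v, 0)) (at (?e, y)) (0, z)"
    for v :: "real^'k" and y z
  have pair: "((\<lambda>y. (?e, y)) has_derivative (\<lambda>z. (0, z))) (at y)" for y :: "real^'n"
    by (auto intro!: derivative_eq_intros)
  have hd: "(h has_derivative frechet_derivative h (at z)) (at z)" if "z \<in> W" for z
    using W(3)[of "Suc 0"] that by (simp add: frechet_derivative_works)
  have dE: "(E v has_derivative DE v y) (at y)" if "y \<in> \<Omega>" for v y
  proof -
    have "(?e, y) \<in> W" using that by (simp add: \<Omega>_def)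
    then have "((\<lambda>z. frechet_derivative h (at z) (v, 0)) has_derivative
        frechet_derivative (\<lambda>z. frechet_derivative h (at z) (v, 0)) (at (?e, y))) (at (?e, y))"
      using W(3)[of "Suc (Suc 0)"] by (simp add: frechet_derivative_works)
    from has_derivative_compose[OF pair this] show ?thesis
      unfolding E_def[abs_def] DE_def[abs_def] .
  qed
  have cDE: "isCont (\<lambda>y. DE v y z) (snd c p)" for v z
  proof -
    have "continuous_on W (\<lambda>x. frechet_derivative (\<lambda>z. frechet_derivative h (at z) (v, 0)) (at x) (0, z))"
      using W(3)[of "Suc (Suc 0)"] by simp
    then have 1: "isCont (\<lambda>x. frechet_derivative (\<lambda>z. frechet_derivative h (at z) (v, 0)) (at x) (0, z)) (?e, snd c p)"
      using W(1,2) by (simp add: continuous_on_eq_continuous_at)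
    have "isCont (Pair ?e) (snd c p)"
      by (intro continuous_intros)
    from isCont_o2[OF this 1] show ?thesis
      unfolding DE_def .
  qed
  \<comment> \<open>The function \<alpha> -> u(h(\<alpha>, y)) is constant on coordinates of group
    elements near the unit, and these contain a short segment in direction \<open>v\<close>. Its
    derivative along \<open>v\<close> is therefore 0, and since h(1, y) = y in coordinates, the
    chain rule writes it as \<open>d (E v y)\<close>.\<close>
  have tangent: "d (E v y) = 0"
    if u: "\<And>a x. a \<in> carrier G \<Longrightarrow> x \<in> ?R \<Longrightarrow> u (\<phi> a x) = u x" and y: "y \<in> \<Omega>"
      and d: "(u \<circ> chart_inv c has_derivative d) (at y)" and v: "v \<in> span (model L)"
    for u :: "'x \<Rightarrow> real" and d v y
  proof -
    obtain x where x: "x \<in> fst c" "x \<in> ?R" "y = snd c x" and yW: "(?e, y) \<in> W"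
      using y unfolding \<Omega>_def by blast
    have xM: "x \<in> points M" using x by (simp add: regular_points_def)
    have cx: "c \<in> charts_at M x" using cM x by (simp add: charts_at_def)
    let ?A = "snd b ` {a \<in> fst b. \<phi> a x \<in> fst c} \<inter> {\<alpha>. (\<alpha>, y) \<in> W}"
    have opW: "open {\<alpha>. (\<alpha>, y) \<in> W}"
      using open_vimage[OF W(1), of "\<lambda>\<alpha>. (\<alpha>, y)"] by (simp add: vimage_def continuous_on_Pair)
    have "inward (snd b ` {a \<in> fst b. \<phi> a x \<in> fst c}) ?e v"
      by (rule orbit_direction_inward[OF xM b cx v])
    moreover have "inward {\<alpha>. (\<alpha>, y) \<in> W} ?e v"
      by (rule inward_openin[of UNIV]) (use opW yW in auto)
    ultimately have inw: "inward ?A ?e v"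
      by (rule inward_Int)
    have hA: "(u \<circ> chart_inv c) (h (\<alpha>, y)) = u x" if \<alpha>: "\<alpha> \<in> ?A" for \<alpha>
    proof -
      obtain a where a: "a \<in> fst b" "\<phi> a x \<in> fst c" "\<alpha> = snd b a" "(\<alpha>, y) \<in> W"
        using \<alpha> by auto
      have "h (\<alpha>, y) = snd c (\<phi> a x)"
        using h[OF a(1) x(1) a(2)] a(3,4) x(3) by simp
      then have "(u \<circ> chart_inv c) (h (\<alpha>, y)) = u (\<phi> a x)"
        using inv_into_f_f[OF injc a(2)] by simp
      also have "\<dots> = u x"
        using u[OF _ x(2)] bG a(1) by blast
      finally show ?thesis .
    qed
    have hy: "h (?e, y) = y"
      using h[OF bL(2) x(1)] x action_one[OF xM] yW by simp
    have hp: "((\<lambda>\<alpha>. h (\<alpha>, y)) has_derivative (\<lambda>v. frechet_derivative h (at (?e, y)) (v, 0))) (at ?e)"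
    proof -
      have "((\<lambda>\<alpha>. (\<alpha>, y)) has_derivative (\<lambda>v. (v, 0))) (at ?e)"
        by (auto intro!: derivative_eq_intros)
      from has_derivative_compose[OF this hd[OF yW]] show ?thesis .
    qed
    have "((\<lambda>\<alpha>. (u \<circ> chart_inv c) (h (\<alpha>, y))) has_derivative
        (\<lambda>v. d (frechet_derivative h (at (?e, y)) (v, 0)))) (at ?e)"
      by (rule has_derivative_compose[OF hp]) (simp only: hy d)
    then have 1: "((\<lambda>\<alpha>. (u \<circ> chart_inv c) (h (\<alpha>, y))) has_derivative
        (\<lambda>v. d (frechet_derivative h (at (?e, y)) (v, 0)))) (at ?e within ?A)"
      by (rule has_derivative_at_withinI)
    have "?e \<in> ?A" using inward_base[OF inw] .
    then have 2: "((\<lambda>\<alpha>. (u \<circ> chart_inv c) (h (\<alpha>, y))) has_derivative (\<lambda>v. 0)) (at ?e within ?A)"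
      by (rule has_derivative_transform[where f = "\<lambda>\<alpha>. u x"]) (use hA in auto)
    show ?thesis
      using derivative_unique_inward[OF 1 2 inw] by (simp add: E_def)
  qed
  obtain O' where O': "open O'" "snd b ` {a \<in> fst b. \<phi> a p \<in> fst c} = model L \<inter> O'"
    using orbit_map_domain_open[OF pM bL(1) cM(1)] by (auto simp: openin_open)
  \<comment> \<open>The factor \<open>O'\<close> keeps the orbit of \<open>p\<close> inside the
    chart \<open>c\<close>, where \<open>h\<close> represents the action.\<close>
  let ?W = "O' \<inter> {\<alpha>. (\<alpha>, snd c p) \<in> W}"
  have "open {\<alpha>. (\<alpha>, snd c p) \<in> W}"
    using open_vimage[OF W(1), of "\<lambda>\<alpha>. (\<alpha>, snd c p)"] by (simp add: vimage_def continuous_on_Pair)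
  then have opW: "open ?W" using O' by auto
  have "?e \<in> snd b ` {a \<in> fst b. \<phi> a p \<in> fst c}"
    using bL cM action_one[OF pM] by auto
  then have eW: "?e \<in> ?W" using O' W(2) by auto
  have "((\<lambda>\<alpha>. (\<alpha>, snd c p)) has_derivative (\<lambda>v. (v, 0))) (at ?e)"
    by (auto intro!: derivative_eq_intros)
  from has_derivative_compose[OF this hd[OF W(2)]]
  have hp: "((\<lambda>\<alpha>. h (\<alpha>, snd c p)) has_derivative (\<lambda>v. E v (snd c p))) (at ?e)"
    by (simp add: E_def)
  have hW: "h (\<alpha>, snd c p) = snd c (\<phi> (chart_inv b \<alpha>) p)" if \<alpha>: "\<alpha> \<in> snd b ` fst b" "\<alpha> \<in> ?W" for \<alpha>
  proof -
    have "\<alpha> \<in> model L"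
      using \<alpha>(1) openin_subset[OF chart_properties(3)[OF L bL(1)]] by auto
    then have "\<alpha> \<in> snd b ` {a \<in> fst b. \<phi> a p \<in> fst c}" using O'(2) \<alpha>(2) by blast
    then obtain a where "a \<in> fst b" "\<phi> a p \<in> fst c" "\<alpha> = snd b a" by auto
    then show ?thesis using h[of a p] cM(2) \<alpha>(2) injb by simp
  qed
  note cd = coord_diff_eqI[where F = "\<lambda>a. \<phi> a p" and d = c and h = "\<lambda>\<alpha>. h (\<alpha>, snd c p)",
      OF eW opW bL(2) hp hW]
  have lin_orbit: "linear (coord_diff b c (\<lambda>a. \<phi> a p) \<one>\<^bsub>G\<^esub>)"
    by (rule cd(1))
  have orbit_diff: "coord_diff b c (\<lambda>a. \<phi> a p) \<one>\<^bsub>G\<^esub> v = E v (snd c p)" if v: "v \<in> span (model L)" for v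
  proof (rule cd(2))
    show "inward (snd b ` fst b) ?e v"
      by (rule inward_mono[OF orbit_direction_inward[OF pM b c v]]) auto
  qed
  let ?\<sigma> = "coord_diff s c (\<lambda>x. x) p"
  have direct: "direct_sum UNIV (?\<sigma> ` span (model S)) (coord_diff b c (\<lambda>a. \<phi> a p) \<one>\<^bsub>G\<^esub> ` span (model L))"
    using polar[of p] pS pb b c s unfolding polar_at_def by blast
  have lin\<sigma>: "linear ?\<sigma>"
    using section_extension[OF pS(1) c s] by metis
  have S1: "span (model S) = UNIV"
  proof -
    have "r \<in> span {0..}" for r :: real
      using span_scale[OF span_base[of "1 :: real" "{0..}"], of r] by simp
    then show ?thesis unfolding section_manifold(1) half_line by blast
  qed
  have "inj_on ?\<sigma> (span (model S))"
    using section_manifold(2) pS c s unfolding immersed_submanifold_def by blast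
  then have \<sigma>1: "?\<sigma> 1 \<noteq> 0"
    using lin\<sigma> S1 by (metis UNIV_I inj_on_eq_iff linear_0 zero_neq_one)
  \<comment> \<open>Polarity splits each coordinate vector into a multiple of the velocity of the
    section and a value at \<open>p\<close> of a fundamental field.\<close>
  have "\<exists>r v. v \<in> span (model L) \<and> axis k 1 = r *\<^sub>R ?\<sigma> 1 + E v (snd c p)" for k :: 'n
  proof -
    have "(axis k 1 :: real^'n) \<in> UNIV" by simp
    then obtain r v where "v \<in> span (model L)"
      "axis k 1 = ?\<sigma> r + coord_diff b c (\<lambda>a. \<phi> a p) \<one>\<^bsub>G\<^esub> v"
      using direct unfolding direct_sum_def by blast
    moreover have "?\<sigma> r = r *\<^sub>R ?\<sigma> 1"
      using linear_scale[OF lin\<sigma>, of r 1] by simp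
    ultimately show ?thesis using orbit_diff by auto
  qed
  then obtain a v where v: "\<And>k. v k \<in> span (model L)"
    and av: "\<And>k. axis k 1 = a k *\<^sub>R ?\<sigma> 1 + E (v k) (snd c p)"
    by metis
  \<comment> \<open>Otherwise every coordinate vector would be tangent to the orbit, hence so would
    the velocity of the section, a nonzero vector common to both summands of a direct sum.\<close>
  have "(\<chi> k. a k) \<noteq> 0"
  proof
    assume "(\<chi> k. a k) = 0"
    then have "a k = 0" for k by (simp add: vec_eq_iff)
    then have ax: "axis k 1 = coord_diff b c (\<lambda>a. \<phi> a p) \<one>\<^bsub>G\<^esub> (v k)" for k
      using av[of k] orbit_diff[OF v, of k] by simp
    let ?v = "\<Sum>k\<in>UNIV. ?\<sigma> 1 $ k *\<^sub>R v k"
    have "?\<sigma> 1 = (\<Sum>k\<in>UNIV. ?\<sigma> 1 $ k *\<^sub>R axis k 1)"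
      using basis_expansion[of "?\<sigma> 1"] by (simp add: scalar_mult_eq_scaleR)
    also have "\<dots> = coord_diff b c (\<lambda>a. \<phi> a p) \<one>\<^bsub>G\<^esub> ?v"
      by (simp add: ax linear_sum[OF lin_orbit] linear_scale[OF lin_orbit])
    finally have "?\<sigma> 1 \<in> ?\<sigma> ` span (model S) \<inter> coord_diff b c (\<lambda>a. \<phi> a p) \<one>\<^bsub>G\<^esub> ` span (model L)"
      using S1 v by (auto intro!: image_eqI[of _ _ ?v] span_sum span_scale)
    with direct \<sigma>1 show False unfolding direct_sum_def by auto
  qed
  show ?thesis
  proof (rule that[OF \<Omega> p\<Omega>, of "\<lambda>k. E (v k)" "\<lambda>k. DE (v k)" "\<chi> k. a k"])
    show "\<Omega> \<subseteq> snd c ` (fst c \<inter> ?R)" by (auto simp: \<Omega>_def)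
    show "(E (v k) has_derivative DE (v k) y) (at y)" if "y \<in> \<Omega>" for k y
      by (rule dE[OF that])
    show "isCont (\<lambda>y. DE (v k) y z) (snd c p)" for k z
      by (rule cDE)
    show "d (E (v k) y) = 0" if "\<And>a x. a \<in> carrier G \<Longrightarrow> x \<in> ?R \<Longrightarrow> u (\<phi> a x) = u x" "y \<in> \<Omega>"
      "(u \<circ> chart_inv c has_derivative d) (at y)" for u :: "'x \<Rightarrow> real" and d k y
      by (rule tangent[OF that v])
    show "axis k 1 = (\<chi> k. a k) $ k *\<^sub>R ?\<sigma> 1 + E (v k) (snd c p)" for k
      using av by simp
  qed fact
qed

end

section \<open>Positive definite matrices and Lipschitz bounds on compact sets\<close>

lemma pos_def_det_nonzero:
  fixes m :: "real^'n::finite^'n"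
  assumes "\<And>v. v \<noteq> 0 \<Longrightarrow> 0 < v \<bullet> (m *v v)"
  shows "det m \<noteq> 0"
proof -
  have "v = 0" if "m *v v = 0" for v
    using assms[of v] that by force
  then show ?thesis
    by (simp add: invertible_det_nz[symmetric] invertible_left_inverse matrix_left_invertible_ker)
qed

text \<open>With \<xi> the solution of \<open>m *v \<xi> = v\<close>, the dual form at
  \<open>v\<close> equals the original form at \<xi>. This yields the ellipticity required of
  \<open>Q\<close> in \<open>radial_unique_continuation\<close>.\<close>

lemma pos_def_matrix_inv:
  fixes m :: "real^'n::finite^'n"
  assumes pos: "\<And>v. v \<noteq> 0 \<Longrightarrow> 0 < v \<bullet> (m *v v)" and "v \<noteq> 0"
  shows "0 < (\<Sum>i\<in>UNIV. \<Sum>j\<in>UNIV. matrix_inv m $ i $ j * (v $ i * v $ j))"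
proof -
  define \<xi> where "\<xi> = matrix_inv m *v v"
  have v: "m *v \<xi> = v"
    using matrix_inv_mult(1)[OF pos_def_det_nonzero[OF pos]]
    by (simp add: \<xi>_def matrix_vector_mul_assoc)
  then have "\<xi> \<noteq> 0" using assms(2) by auto
  then have "0 < v \<bullet> \<xi>"
    using pos[of \<xi>] v by (simp add: inner_commute)
  also have "v \<bullet> \<xi> = (\<Sum>i\<in>UNIV. \<Sum>j\<in>UNIV. matrix_inv m $ i $ j * (v $ i * v $ j))"
    by (simp add: \<xi>_def inner_vec_def matrix_vector_mult_def sum_distrib_left mult_ac)
  finally show ?thesis .
qed

lemma radial_nonlinearity_Lipschitz:
  assumes f: "radial_nonlinearity G M \<phi> Y f" and K: "compactin (mtop M) K"
    and B: "compact B" "B \<subseteq> Y"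
  obtains C where "\<And>x y1 y2. x \<in> K \<Longrightarrow> y1 \<in> B \<Longrightarrow> y2 \<in> B \<Longrightarrow> \<bar>f x y1 - f x y2\<bar> \<le> C * \<bar>y1 - y2\<bar>"
proof -
  have "compactin (prod_topology (mtop M) (top_of_set Y)) (K \<times> B)"
    using K B by (simp add: compactin_Times compactin_subtopology)
  then obtain C where
    "\<forall>x y1 y2. (x, y1) \<in> K \<times> B \<and> (x, y2) \<in> K \<times> B \<longrightarrow> \<bar>f x y1 - f x y2\<bar> \<le> C * \<bar>y1 - y2\<bar>"
    using f unfolding radial_nonlinearity_def by blast
  then show ?thesis using that[of C] by blast
qed

section \<open>Uniqueness near a point of the section and its propagation\<close>

context polar_setting
begin

lemma metric_pos:
  assumes "c \<in> charts M" "x \<in> fst c" "v \<noteq> 0"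
  shows "0 < v \<bullet> (g c x *v v)"
proof -
  have "x \<in> points M"
    using openin_subset[OF chart_properties(1)[OF manifold(1) assms(1)]] assms(2) by auto
  then show ?thesis
    using metric assms unfolding riemannian_metric_def charts_at_def by blast
qed

lemma metric_in_chart:
  assumes c: "c \<in> charts M" and U: "open U" "y \<in> U" "U \<subseteq> snd c ` fst c"
  obtains W where "open W" "y \<in> W" "W \<subseteq> U"
    "\<And>i j. C_open (Suc 0) (\<lambda>y. g c (chart_inv c y) $ i $ j) W"
proof -
  have "C_on \<infinity> (snd c ` fst c) (g c \<circ> chart_inv c)"
    using metric c by (simp add: riemannian_metric_def)
  from C_on_open[OF this subsetD[OF U(3,2)] U]
  obtain W where W: "open W" "y \<in> W" "W \<subseteq> U" "\<And>k. enat k \<le> \<infinity> \<Longrightarrow> C_open k (g c \<circ> chart_inv c) W"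
    by blast
  then have "C_open (Suc 0) (\<lambda>y. g c (chart_inv c y)) W"
    by (simp only: comp_def enat_ord_simps)
  from that[OF W(1-3) C_open_1_component[OF this]] show ?thesis .
qed

lemma solution_in_chart:
  assumes u: "maximal_radial_solution G M g \<phi> f u" and c: "c \<in> charts M"
    and U: "open U" "y \<in> U" "U \<subseteq> snd c ` (fst c \<inter> regular_part G M \<phi>)"
  obtains W where "open W" "y \<in> W" "W \<subseteq> U" "C_open (Suc (Suc 0)) (u \<circ> chart_inv c) W"
proof -
  have "C_on 2 (snd c ` (fst c \<inter> regular_part G M \<phi>)) (u \<circ> chart_inv c)"
    using u c by (simp add: maximal_radial_solution_def C_fun_def)
  from C_on_open[OF this subsetD[OF U(3,2)] U]
  obtain W where W: "open W" "y \<in> W" "W \<subseteq> U" "\<And>k. enat k \<le> 2 \<Longrightarrow> C_open k (u \<circ> chart_inv c) W"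
    by blast
  have "enat (Suc (Suc 0)) \<le> 2"
    by (simp add: numeral_eq_enat)
  from that[OF W(1-3) W(4)[OF this]] show ?thesis .
qed

text \<open>One neighbourhood serves two purposes: data of first order at \<open>p\<close> start the
  coincidence, and coincidence on any nonempty open part of \<open>U\<close> extends to
  \<open>U\<close>. The set \<open>Y\<close> contains the values of both solutions, so that
  arbitrary sign and positive solutions are treated together.\<close>

lemma local_uniqueness:
  assumes f: "radial_nonlinearity G M \<phi> Y f"
    and u1: "maximal_radial_solution G M g \<phi> f u1" and u2: "maximal_radial_solution G M g \<phi> f u2"
    and Y: "\<And>x. x \<in> regular_part G M \<phi> \<Longrightarrow> u1 x \<in> Y \<and> u2 x \<in> Y"
    and p: "p \<in> regular_section G M \<phi> S"
  obtains U where "openin (mtop S) U" "p \<in> U" "U \<subseteq> regular_section G M \<phi> S"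
    "\<And>V. openin (mtop S) V \<Longrightarrow> V \<subseteq> U \<Longrightarrow> V \<noteq> {} \<Longrightarrow> \<forall>x\<in>V. u1 x = u2 x \<Longrightarrow> \<forall>x\<in>U. u1 x = u2 x"
    "u1 p = u2 p \<Longrightarrow> \<forall>c\<in>charts_at M p. gradient g c u1 p = gradient g c u2 p \<Longrightarrow>
      \<forall>x\<in>U. u1 x = u2 x"
proof -
  let ?R = "regular_part G M \<phi>"
  have pR: "p \<in> ?R" and pM: "p \<in> points M" and pS: "p \<in> points S"
    using p section_in_regular_part by (auto simp: regular_points_def)
  have S: "smooth_manifold S"
    using section_manifold(2) by (simp add: immersed_submanifold_def)
  obtain c where c: "c \<in> charts_at M p"
    using manifold(1) pM unfolding smooth_manifold_def charts_at_def by blast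
  obtain s where s: "s \<in> charts_at S p"
    using S pS unfolding smooth_manifold_def charts_at_def by blast
  have cM: "c \<in> charts M" "p \<in> fst c" and sS: "s \<in> charts S" "p \<in> fst s"
    using c s by (auto simp: charts_at_def)
  have injc: "inj_on (snd c) (fst c)" by (rule chart_properties(2)[OF manifold(1) cM(1)])
  have injs: "inj_on (snd s) (fst s)" by (rule chart_properties(2)[OF S sS(1)])
  let ?y = "snd c p" and ?t = "snd s p"
  obtain \<Omega> X DX and a :: "real^'n"
    where \<Omega>: "open \<Omega>" "?y \<in> \<Omega>" "\<Omega> \<subseteq> snd c ` (fst c \<inter> ?R)"
      and X: "\<And>k y. y \<in> \<Omega> \<Longrightarrow> (X k has_derivative DX k y) (at y)"
      and DX: "\<And>k v. isCont (\<lambda>y. DX k y v) ?y"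
      and tangent: "\<And>u d k y. \<lbrakk>\<And>a x. a \<in> carrier G \<Longrightarrow> x \<in> ?R \<Longrightarrow> u (\<phi> a x) = u x; y \<in> \<Omega>;
         (u \<circ> chart_inv c has_derivative d) (at y)\<rbrakk> \<Longrightarrow> d (X k y) = (0::real)"
      and frame: "\<And>k. axis k 1 = a $ k *\<^sub>R coord_diff s c (\<lambda>x. x) p 1 + X k ?y"
      and a: "a \<noteq> 0"
    by (rule radial_frame[OF p c s]) blast
  obtain T \<tau> where T: "open T" "?t \<in> T" "\<And>k. C_open k \<tau> T"
    and \<tau>: "\<And>x. x \<in> fst s \<Longrightarrow> snd s x \<in> T \<Longrightarrow> x \<in> fst c \<and> \<tau> (snd s x) = snd c x"
    and \<tau>1: "coord_diff s c (\<lambda>x. x) p 1 = frechet_derivative \<tau> (at ?t) 1"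
    by (rule section_extension[OF pS c s]) blast
  obtain N1 where N1: "open N1" "?y \<in> N1" "N1 \<subseteq> \<Omega>" "C_open (Suc (Suc 0)) (u1 \<circ> chart_inv c) N1"
    by (rule solution_in_chart[OF u1 cM(1) \<Omega>])
  have "N1 \<subseteq> snd c ` (fst c \<inter> ?R)" using N1 \<Omega> by blast
  then obtain N2 where N2: "open N2" "?y \<in> N2" "N2 \<subseteq> N1" "C_open (Suc (Suc 0)) (u2 \<circ> chart_inv c) N2"
    by (rule solution_in_chart[OF u2 cM(1) N1(1,2)])
  have "N2 \<subseteq> snd c ` fst c" using N2 N1 \<Omega> by blast
  then obtain N where N: "open N" "?y \<in> N" "N \<subseteq> N2"
    and q: "\<And>i j. C_open (Suc 0) (\<lambda>y. g c (chart_inv c y) $ i $ j) N"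
    by (rule metric_in_chart[OF cM(1) N2(1,2)]) blast
  obtain r where r: "r > 0" "cball ?y r \<subseteq> N"
    using N(1,2) open_contains_cball by blast
  let ?B = "ball ?y r"
  let ?h1 = "u1 \<circ> chart_inv c" and ?h2 = "u2 \<circ> chart_inv c"
  have sub: "?B \<subseteq> N" "?B \<subseteq> \<Omega>" "cball ?y r \<subseteq> snd c ` (fst c \<inter> ?R)"
    using r N N2 N1 \<Omega> by (auto dest!: subsetD[OF ball_subset_cball])
  have h1: "C_open (Suc (Suc 0)) ?h1 N" and h2: "C_open (Suc (Suc 0)) ?h2 N"
    by (rule C_open_transform[OF N1(4) N(1)] C_open_transform[OF N2(4) N(1)]; use N N2 in auto)+
  have inv: "chart_inv c y \<in> fst c \<inter> ?R" "snd c (chart_inv c y) = y" if "y \<in> snd c ` (fst c \<inter> ?R)" for y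
    using that injc by auto
  have nz: "det (g c (chart_inv c y)) \<noteq> 0" if "y \<in> N" for y
  proof (rule pos_def_det_nonzero)
    have "y \<in> snd c ` (fst c \<inter> ?R)" using that N N2 N1 \<Omega> by blast
    then show "0 < v \<bullet> (g c (chart_inv c y) *v v)" if "v \<noteq> 0" for v
      using metric_pos[OF cM(1) _ that] inv(1) by blast
  qed
  \<comment> \<open>The closed ball is compact, and so is the union of the ranges of both solutions
    over it, which lies in \<open>Y\<close>; the local Lipschitz condition then gives one
    constant.\<close>
  obtain C where C: "\<And>y. y \<in> cball ?y r \<Longrightarrow>
      \<bar>f (chart_inv c y) (?h1 y) - f (chart_inv c y) (?h2 y)\<bar> \<le> C * \<bar>?h1 y - ?h2 y\<bar>"
  proof -
    have K: "compactin (mtop M) (chart_inv c ` cball ?y r)"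
    proof (rule image_compactin[OF _ chart_properties(4)[OF manifold(1) cM(1)]])
      show "compactin (top_of_set (snd c ` fst c)) (cball ?y r)"
        using sub(3) by (auto simp: compactin_subtopology)
    qed
    have "continuous_on N h" if "C_open (Suc (Suc 0)) h N" for h :: "real^'n \<Rightarrow> real"
      using that by (auto intro!: differentiable_imp_continuous_on differentiable_at_imp_differentiable_on)
    then have cont: "continuous_on (cball ?y r) ?h1" "continuous_on (cball ?y r) ?h2"
      using continuous_on_subset[OF _ r(2)] h1 h2 by blast+
    have B: "compact (?h1 ` cball ?y r \<union> ?h2 ` cball ?y r)"
      by (intro compact_Un compact_continuous_image cont compact_cball)
    have "?h1 ` cball ?y r \<union> ?h2 ` cball ?y r \<subseteq> Y"
      using Y inv(1) sub(3) by fastforce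
    from radial_nonlinearity_Lipschitz[OF f K B this] obtain C where
      "\<And>x y1 y2. x \<in> chart_inv c ` cball ?y r \<Longrightarrow> y1 \<in> ?h1 ` cball ?y r \<union> ?h2 ` cball ?y r \<Longrightarrow>
        y2 \<in> ?h1 ` cball ?y r \<union> ?h2 ` cball ?y r \<Longrightarrow> \<bar>f x y1 - f x y2\<bar> \<le> C * \<bar>y1 - y2\<bar>"
      by blast
    then show ?thesis using that[of C] by blast
  qed
  let ?q = "\<lambda>y. g c (chart_inv c y)"
  define w where "w y = ?h1 y - ?h2 y" for y
  define D where "D y = grad ?h1 y - grad ?h2 y" for y
  define H where "H y = hess ?h1 y - hess ?h2 y" for y
  define \<sigma>1 where "\<sigma>1 t = frechet_derivative \<tau> (at t) 1" for t
  define \<sigma>2 where "\<sigma>2 t = frechet_derivative \<sigma>1 (at t) 1" for t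
  note so1 = C_open_2_second_order[OF N(1) h1] and so2 = C_open_2_second_order[OF N(1) h2]
  have dw: "(w has_derivative (\<lambda>v. D y \<bullet> v)) (at y)" if "y \<in> N" for y
    unfolding w_def[abs_def] D_def inner_diff_left
    by (rule has_derivative_diff[OF so1(1)[OF that] so2(1)[OF that]])
  have d\<tau>: "(\<tau> has_vector_derivative \<sigma>1 t) (at t)" if "t \<in> T" for t
    using T(3)[of "Suc 0"] that
    by (simp add: \<sigma>1_def frechet_derivative_eq_vector_derivative vector_derivative_works[symmetric])
  have d\<sigma>1: "(\<sigma>1 has_vector_derivative \<sigma>2 t) (at t)" if "t \<in> T" for t
  proof -
    have "\<sigma>1 differentiable (at t)"
      using T(3)[of "Suc (Suc 0)"] that by (simp add: \<sigma>1_def[abs_def])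
    then show ?thesis
      by (simp add: \<sigma>2_def frechet_derivative_eq_vector_derivative vector_derivative_works[symmetric])
  qed
  have "continuous_on T \<sigma>2"
    using T(3)[of "Suc (Suc 0)"] by (simp add: \<sigma>2_def[abs_def] \<sigma>1_def[abs_def])
  then have c\<sigma>2: "isCont \<sigma>2 ?t"
    using T(1,2) by (simp add: continuous_on_eq_continuous_at)
  have \<tau>0: "\<tau> ?t = ?y" using \<tau>[OF sS(2) T(2)] by simp
  \<comment> \<open>Past an end point of the half-line the curve \<tau> may leave the section. The
    equation and the radial identities hold on the whole coordinate ball, so the estimate along
    \<tau> is valid there too.\<close>
  have "\<exists>\<epsilon>>0. \<forall>s\<in>ball ?t \<epsilon>. w (\<tau> s) = 0 \<longrightarrow> D (\<tau> s) \<bullet> \<sigma>1 s = 0 \<longrightarrow> (\<forall>t\<in>ball ?t \<epsilon>. w (\<tau> t) = 0)"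
  proof (rule radial_unique_continuation[where \<Omega> = ?B and X = X and DX = DX and H = H and a = a
        and Q = "\<lambda>y. matrix_inv (?q y)" and b = "drift ?q" and C = C])
    show "open ?B" "\<tau> ?t \<in> ?B" using r(1) \<tau>0 by auto
    show "(w has_derivative (\<lambda>v. D y \<bullet> v)) (at y)" if "y \<in> ?B" for y
      using dw that sub(1) by blast
    show "(D has_derivative (\<lambda>z. H y *v z)) (at y)" if "y \<in> ?B" for y
    proof -
      have "y \<in> N" using that sub(1) by blast
      from has_derivative_diff[OF so1(2)[OF this] so2(2)[OF this]] show ?thesis
        by (simp add: D_def[abs_def] H_def matrix_vector_mult_diff_rdistrib)
    qed
    show "transpose (H y) = H y" if "y \<in> ?B" for y
    proof -
      have "y \<in> N" using that sub(1) by blast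
      from so1(3)[OF this] so2(3)[OF this] show ?thesis
        by (simp add: H_def transpose_def vec_eq_iff)
    qed
    show "(X k has_derivative DX k y) (at y)" if "y \<in> ?B" for k y
      using X that sub(2) by blast
    show "isCont (\<lambda>y. DX k y v) (\<tau> ?t)" for k v
      using DX by (simp add: \<tau>0)
    show "D y \<bullet> X k y = 0" if "y \<in> ?B" for k y
    proof -
      have y: "y \<in> N" "y \<in> \<Omega>" using that sub(1,2) by auto
      have "grad ?h1 y \<bullet> X k y = 0"
        by (rule tangent[OF _ y(2) so1(1)[OF y(1)]]) (use u1 in \<open>simp add: maximal_radial_solution_def\<close>)
      moreover have "grad ?h2 y \<bullet> X k y = 0"
        by (rule tangent[OF _ y(2) so2(1)[OF y(1)]]) (use u2 in \<open>simp add: maximal_radial_solution_def\<close>)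
      ultimately show ?thesis by (simp add: D_def inner_diff_left)
    qed
    show "axis k 1 = a $ k *\<^sub>R \<sigma>1 ?t + X k (\<tau> ?t)" for k
      using frame[of k] \<tau>1 by (simp add: \<sigma>1_def \<tau>0)
    have cinv: "continuous_on N (\<lambda>y. matrix_inv (?q y) $ i $ j)" for i j
      by (intro C_open_Suc_0_continuous C_open_1_matrix_inv q N(1) nz)
    show "isCont (\<lambda>y. matrix_inv (?q y) $ i $ j) (\<tau> ?t)" for i j
      using cinv N by (simp add: \<tau>0 continuous_on_eq_continuous_at)
    show "0 < (\<Sum>i\<in>UNIV. \<Sum>j\<in>UNIV. matrix_inv (?q (\<tau> ?t)) $ i $ j * (v $ i * v $ j))" if "v \<noteq> 0" for v
      by (rule pos_def_matrix_inv[OF metric_pos[OF cM(1)] that]) (use injc cM in \<open>simp add: \<tau>0\<close>)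
    show "isCont (drift ?q) (\<tau> ?t)"
      using isCont_drift[OF N(1) q nz N(2)] by (simp add: \<tau>0)
    show "\<bar>(\<Sum>i\<in>UNIV. \<Sum>j\<in>UNIV. matrix_inv (?q y) $ i $ j * H y $ i $ j) + drift ?q y \<bullet> D y\<bar> \<le> C * \<bar>w y\<bar>"
      if "y \<in> ?B" for y
    proof -
      have y: "y \<in> N" "y \<in> cball ?y r" "y \<in> snd c ` (fst c \<inter> ?R)"
        using that sub by auto
      let ?x = "chart_inv c y"
      have x: "?x \<in> ?R" "c \<in> charts_at M ?x" "snd c ?x = y"
        using inv[OF y(3)] cM by (auto simp: charts_at_def)
      have "laplace_beltrami g c u1 ?x = f ?x (u1 ?x)" "laplace_beltrami g c u2 ?x = f ?x (u2 ?x)"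
        using u1 u2 x(1,2) unfolding maximal_radial_solution_def by (smt (verit))+
      moreover have "laplace_beltrami g c u1 ?x - laplace_beltrami g c u2 ?x =
          (\<Sum>i\<in>UNIV. \<Sum>j\<in>UNIV. matrix_inv (?q y) $ i $ j * H y $ i $ j) + drift ?q y \<bullet> D y"
        using laplace_beltrami_expansion[where g = g and c = c, OF N(1) q nz h1 x(3) y(1)]
          laplace_beltrami_expansion[where g = g and c = c, OF N(1) q nz h2 x(3) y(1)]
        by (simp add: H_def D_def inner_diff_right right_diff_distrib sum_subtractf)
      ultimately show ?thesis
        using C[OF y(2)] by (simp add: w_def)
    qed
  qed (use T d\<tau> d\<sigma>1 c\<sigma>2 a in blast)+
  then obtain \<epsilon> where "\<epsilon> > 0" and \<epsilon>: "\<And>s t. s \<in> ball ?t \<epsilon> \<Longrightarrow> w (\<tau> s) = 0 \<Longrightarrow> D (\<tau> s) \<bullet> \<sigma>1 s = 0 \<Longrightarrow>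
      t \<in> ball ?t \<epsilon> \<Longrightarrow> w (\<tau> t) = 0"
    by blast
  \<comment> \<open>Parameters at which the vanishing criterion applies, \<tau> follows the section
    wherever that has points, and the difference \<open>w\<close> is differentiable at the point of
    the curve.\<close>
  define B' where "B' = ball ?t \<epsilon> \<inter> (T \<inter> \<tau> -` N)"
  have "continuous_on T \<tau>"
    using T(3)[of 0] by simp
  then have "open (T \<inter> \<tau> -` N)"
    by (rule continuous_open_preimage[OF _ T(1) N(1)])
  then have B': "open B'" "?t \<in> B'"
    using \<open>\<epsilon> > 0\<close> T(2) \<tau>0 N(2) by (auto simp: B'_def)
  define U where "U = {x \<in> fst s. snd s x \<in> snd s ` fst s \<inter> B'} \<inter> regular_section G M \<phi> S"
  have wU: "w (\<tau> (snd s x)) = u1 x - u2 x" if "x \<in> U" for x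
  proof -
    have "x \<in> fst c" "\<tau> (snd s x) = snd c x"
      using \<tau>[of x] that by (auto simp: U_def B'_def)
    then show ?thesis using injc by (simp add: w_def)
  qed
  have vanish: "u1 x = u2 x" if "x0 \<in> U" "w (\<tau> (snd s x0)) = 0" "D (\<tau> (snd s x0)) \<bullet> \<sigma>1 (snd s x0) = 0" "x \<in> U"
    for x0 x
    using \<epsilon>[OF _ that(2,3), of "snd s x"] wU[OF that(4)] that(1,4) by (auto simp: U_def B'_def)
  show ?thesis
  proof (rule that)
    show "openin (mtop S) U"
      unfolding U_def
      by (intro openin_Int sigma(1) chart_properties(6)[OF S sS(1)] openin_open_Int B')
    show pU: "p \<in> U" "U \<subseteq> regular_section G M \<phi> S"
      using p sS B' by (auto simp: U_def)
    show "\<forall>x\<in>U. u1 x = u2 x" if V: "openin (mtop S) V" "V \<subseteq> U" "V \<noteq> {}" "\<forall>x\<in>V. u1 x = u2 x" for V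
    proof -
      obtain x0 where x0: "x0 \<in> V" using V(3) by blast
      let ?s = "snd s x0"
      have x0U: "x0 \<in> U" using x0 V(2) by blast
      then have s0: "?s \<in> T" "\<tau> ?s \<in> N" "x0 \<in> fst s" by (auto simp: U_def B'_def)
      let ?A = "snd s ` (fst s \<inter> V)"
      have o: "openin (top_of_set half_space) ?A"
        using chart_properties(5)[OF S sS(1) V(1)] section_manifold(1) by simp
      \<comment> \<open>In the coordinate of the section, \<open>V\<close> contains a right-hand
        interval starting at \<open>x0\<close>. As \<open>w\<close> vanishes along it, the one-sided
        derivative, and so the derivative along \<tau>, is 0 at \<open>x0\<close>.\<close>
      have inw: "inward ?A ?s 1"
      proof (rule inward_openin[OF o])
        show "?s \<in> ?A" using x0 s0(3) by auto
        then have "?s \<in> half_space" using openin_subset[OF o] by auto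
        then show "?s + r *\<^sub>R 1 \<in> half_space" if "0 \<le> r" for r
          using that by (simp add: half_line)
      qed
      have "((\<lambda>t. w (\<tau> t)) has_derivative (\<lambda>h. D (\<tau> ?s) \<bullet> (h *\<^sub>R \<sigma>1 ?s))) (at ?s)"
        using has_derivative_compose[OF d\<tau>[OF s0(1), unfolded has_vector_derivative_def] dw[OF s0(2)]] .
      then have 1: "((\<lambda>t. w (\<tau> t)) has_derivative (\<lambda>h. D (\<tau> ?s) \<bullet> (h *\<^sub>R \<sigma>1 ?s))) (at ?s within ?A)"
        by (rule has_derivative_at_withinI)
      have 0: "w (\<tau> t) = 0" if "t \<in> ?A" for t
        using that V(2,4) wU by auto
      have 2: "((\<lambda>t. w (\<tau> t)) has_derivative (\<lambda>h. 0)) (at ?s within ?A)"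
        by (rule has_derivative_transform[where f = "\<lambda>t. 0", OF inward_base[OF inw] 0]) auto
      have "D (\<tau> ?s) \<bullet> \<sigma>1 ?s = 0"
        using derivative_unique_inward[OF 1 2 inw] by simp
      moreover have "w (\<tau> ?s) = 0"
        using 0 inward_base[OF inw] by blast
      ultimately show ?thesis using vanish[OF x0U] by blast
    qed
    show "\<forall>x\<in>U. u1 x = u2 x"
      if eq: "u1 p = u2 p" "\<forall>c\<in>charts_at M p. gradient g c u1 p = gradient g c u2 p"
    proof -
      \<comment> \<open>Multiplication by the metric matrix turns equality of Riemannian gradients
        into equality of the partial derivatives.\<close>
      have "matrix_inv (g c p) *v grad ?h1 ?y = matrix_inv (g c p) *v grad ?h2 ?y"
        using eq(2) c by (simp add: gradient_def grad_def)
      then have "g c p *v (matrix_inv (g c p) *v grad ?h1 ?y) = g c p *v (matrix_inv (g c p) *v grad ?h2 ?y)"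
        by simp
      moreover have "det (g c p) \<noteq> 0"
        by (rule pos_def_det_nonzero[OF metric_pos[OF cM]])
      ultimately have "grad ?h1 ?y = grad ?h2 ?y"
        by (simp add: matrix_vector_mul_assoc matrix_inv_mult)
      then have "D (\<tau> ?t) \<bullet> \<sigma>1 ?t = 0" by (simp add: \<tau>0 D_def)
      moreover have "w (\<tau> ?t) = 0" using wU[OF pU(1)] eq(1) by simp
      ultimately show ?thesis using vanish[OF pU(1)] by blast
    qed
  qed
qed

text \<open>Leaving the range \<open>Y\<close> of the solutions open makes all three claims
  instances of this one: \<open>Y\<close> is the whole line for (i) and (ii), and the positive
  half-line for (iii).\<close>

theorem unique_continuation:
  assumes f: "radial_nonlinearity G M \<phi> Y f"
    and u1: "maximal_radial_solution G M g \<phi> f u1" and u2: "maximal_radial_solution G M g \<phi> f u2"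
    and Y: "\<And>x. x \<in> regular_part G M \<phi> \<Longrightarrow> u1 x \<in> Y \<and> u2 x \<in> Y"
    and p: "p \<in> regular_section G M \<phi> S" "u1 p = u2 p"
      "\<forall>c\<in>charts_at M p. gradient g c u1 p = gradient g c u2 p"
    and x: "x \<in> regular_part G M \<phi>"
  shows "u1 x = u2 x"
proof -
  let ?\<Sigma> = "regular_section G M \<phi> S"
  \<comment> \<open>The interior of the coincidence set is used rather than the set itself, because
    equal values at a single point say nothing about the derivatives there.\<close>
  define E where "E = \<Union>{V. openin (mtop S) V \<and> V \<subseteq> ?\<Sigma> \<and> (\<forall>x\<in>V. u1 x = u2 x)}"
  have E: "openin (mtop S) E" "E \<subseteq> ?\<Sigma>" "\<And>x. x \<in> E \<Longrightarrow> u1 x = u2 x"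
    by (auto simp: E_def)
  have E_max: "V \<subseteq> E" if "openin (mtop S) V" "V \<subseteq> ?\<Sigma>" "\<And>x. x \<in> V \<Longrightarrow> u1 x = u2 x" for V
    using that by (auto simp: E_def)
  have "p \<in> E"
  proof -
    obtain U where U: "openin (mtop S) U" "p \<in> U" "U \<subseteq> ?\<Sigma>" and eq: "\<forall>x\<in>U. u1 x = u2 x"
      by (rule local_uniqueness[OF f u1 u2 Y p(1)]) (use p(2,3) in blast)+
    then show ?thesis using E_max[OF U(1,3)] by blast
  qed
  have "openin (mtop S) (?\<Sigma> - E)"
  proof (rule openin_subopen[THEN iffD2], rule ballI)
    fix z assume z: "z \<in> ?\<Sigma> - E"
    obtain U where U: "openin (mtop S) U" "z \<in> U" "U \<subseteq> ?\<Sigma>"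
      and cont: "\<And>V. openin (mtop S) V \<Longrightarrow> V \<subseteq> U \<Longrightarrow> V \<noteq> {} \<Longrightarrow> \<forall>x\<in>V. u1 x = u2 x \<Longrightarrow> \<forall>x\<in>U. u1 x = u2 x"
      by (rule local_uniqueness[OF f u1 u2 Y, of z]) (use z in blast)+
    have "U \<inter> E = {}"
    proof (rule ccontr)
      assume "U \<inter> E \<noteq> {}"
      then have "\<forall>x\<in>U. u1 x = u2 x"
        using E U(1) by (intro cont[of "U \<inter> E"]) auto
      then have "U \<subseteq> E" using E_max[OF U(1,3)] by blast
      then show False using z U(2) by blast
    qed
    then show "\<exists>T. openin (mtop S) T \<and> z \<in> T \<and> T \<subseteq> ?\<Sigma> - E"
      using U by blast
  qed
  then have "?\<Sigma> - E = {}"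
    using connectedinD[OF sigma(2) E(1), of "?\<Sigma> - E"] \<open>p \<in> E\<close> p(1) by blast
  then have eq: "u1 z = u2 z" if "z \<in> ?\<Sigma>" for z
    using E(3) that by blast
  obtain z b where z: "z \<in> ?\<Sigma>" "b \<in> carrier G" "x = \<phi> b z"
    using x unfolding regular_orbits orbit_def by blast
  have "z \<in> regular_part G M \<phi>" using z(1) section_in_regular_part by blast
  then have "u1 x = u1 z" "u2 x = u2 z"
    using u1 u2 z(2,3) by (simp_all add: maximal_radial_solution_def)
  then show ?thesis using eq[OF z(1)] by simp
qed

end

section \<open>The zero solution and the three statements\<close>

lemma C_open_zero: "C_open k (\<lambda>_. 0) U"
  by (induction k) auto

lemma gradient_zero: "gradient g c (\<lambda>_. 0) x = 0"
  by (simp add: gradient_def comp_def partial_def zero_vec_def[symmetric])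

text \<open>Under f(., 0) = 0 the zero function is a competitor, so (ii) becomes uniqueness for the
  pair consisting of \<open>u\<close> and 0.\<close>

lemma maximal_radial_solution_zero:
  fixes M :: "('x, real^'n::finite) mfd"
  assumes "\<forall>x\<in>points M. f x 0 = 0"
  shows "maximal_radial_solution G M g \<phi> f (\<lambda>_. 0)"
proof -
  have "C_on 2 A (\<lambda>_::real^'n. 0::real)" for A
    unfolding C_on_def using C_open_zero by (intro ballI exI[of _ UNIV] exI[of _ "\<lambda>_. 0"]) auto
  then show ?thesis
    using assms
    by (simp add: maximal_radial_solution_def C_fun_def comp_def laplace_beltrami_def Let_def partial_def
        regular_points_def)
qed

theorem theorem2p6:
  fixes M :: "('x, real^'n::finite) mfd"
    and g :: "('x, 'n) metric"
    and G :: "'a monoid"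
    and L :: "('a, real^'k::finite) mfd"
    and \<phi> :: "'a \<Rightarrow> 'x \<Rightarrow> 'x"
    and S :: "('x, real) mfd"
    and A :: "'x \<Rightarrow> real"
  assumes "polar_setting M g G L \<phi> S A"
    and "unimodular G (mtop L)"
  shows
    "(\<forall>f u1 u2 p.
        radial_nonlinearity G M \<phi> UNIV f \<longrightarrow>
        maximal_radial_solution G M g \<phi> f u1 \<longrightarrow>
        maximal_radial_solution G M g \<phi> f u2 \<longrightarrow>
        p \<in> regular_section G M \<phi> S \<longrightarrow> u1 p = u2 p \<longrightarrow>
        (\<forall>c\<in>charts_at M p. gradient g c u1 p = gradient g c u2 p) \<longrightarrow>
        (\<forall>x\<in>regular_part G M \<phi>. u1 x = u2 x)) \<and>
     (\<forall>f u p.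
        radial_nonlinearity G M \<phi> UNIV f \<longrightarrow>
        (\<forall>x\<in>points M. f x 0 = 0) \<longrightarrow>
        maximal_radial_solution G M g \<phi> f u \<longrightarrow>
        p \<in> regular_section G M \<phi> S \<longrightarrow> u p = 0 \<longrightarrow>
        (\<forall>c\<in>charts_at M p. gradient g c u p = 0) \<longrightarrow>
        (\<forall>x\<in>regular_part G M \<phi>. u x = 0)) \<and>
     (\<forall>f u1 u2 p.
        radial_nonlinearity G M \<phi> {0<..} f \<longrightarrow>
        maximal_radial_solution G M g \<phi> f u1 \<longrightarrow>
        maximal_radial_solution G M g \<phi> f u2 \<longrightarrow>
        (\<forall>x\<in>regular_part G M \<phi>. u1 x > 0 \<and> u2 x > 0) \<longrightarrow>
        p \<in> regular_section G M \<phi> S \<longrightarrow> u1 p = u2 p \<longrightarrow>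
        (\<forall>c\<in>charts_at M p. gradient g c u1 p = gradient g c u2 p) \<longrightarrow>
        (\<forall>x\<in>regular_part G M \<phi>. u1 x = u2 x))"
proof (intro conjI allI impI ballI)
  interpret polar_setting M g G L \<phi> S A by fact
  show "u1 x = u2 x"
    if "radial_nonlinearity G M \<phi> UNIV f" "maximal_radial_solution G M g \<phi> f u1"
      "maximal_radial_solution G M g \<phi> f u2" "p \<in> regular_section G M \<phi> S" "u1 p = u2 p"
      "\<forall>c\<in>charts_at M p. gradient g c u1 p = gradient g c u2 p" "x \<in> regular_part G M \<phi>"
    for f u1 u2 p x
    using unique_continuation[OF that(1-3) _ that(4-7)] by simp
  show "u x = 0"
    if "radial_nonlinearity G M \<phi> UNIV f" "\<forall>x\<in>points M. f x 0 = 0" "maximal_radial_solution G M g \<phi> f u"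
      "p \<in> regular_section G M \<phi> S" "u p = 0" "\<forall>c\<in>charts_at M p. gradient g c u p = 0"
      "x \<in> regular_part G M \<phi>"
    for f u p x
    using unique_continuation[OF that(1,3) maximal_radial_solution_zero[where f = f and M = M, OF that(2)] _ that(4,5) _ that(7)]
      that(6) by (simp add: gradient_zero)
  show "u1 x = u2 x"
    if "radial_nonlinearity G M \<phi> {0<..} f" "maximal_radial_solution G M g \<phi> f u1"
      "maximal_radial_solution G M g \<phi> f u2" "\<forall>x\<in>regular_part G M \<phi>. u1 x > 0 \<and> u2 x > 0"
      "p \<in> regular_section G M \<phi> S" "u1 p = u2 p"
      "\<forall>c\<in>charts_at M p. gradient g c u1 p = gradient g c u2 p" "x \<in> regular_part G M \<phi>"
    for f u1 u2 p x
    using unique_continuation[OF that(1-3) _ that(5-8)] that(4) by simp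
qed

end
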